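(* For every real $\varepsilon>0$, there exist infinitely many pairs $(m,n)\in\mathbb{N}^2$ such that $$\left|\sum_{\ell=n}^{m}\frac{1}{\ell}-1\right| \leq \frac{1}{n^2(\log n)^{(5/4)-\varepsilon}}.$$
   Context: $\mathbb{N}$ denotes the set of positive integers and $\log$ is the natural logarithm. *)

theory Defs
  imports Complex_Main
begin

end

theory Submission
  imports Defs "HOL-Analysis.Analysis"
begin

text \<open>
  For odd \<open>p = 2 m + 1\<close> and \<open>q = 2 n - 1\<close> the sum of \<open>1 / l\<close> over \<open>n \<le> l \<le> m\<close> is
  \<open>ln (p / q) + (1 / p\<^sup>2 - 1 / q\<^sup>2) / 6 + O(1 / q\<^sup>3)\<close>, so it is close to \<open>1\<close> when \<open>q (p - e q)\<close> is close to
  \<open>c = sinh 1 / 3\<close>. The convergents \<open>P / Q\<close> of \<open>e\<close> given by the diagonal Pade approximants have odd \<open>P\<close> and \<open>Q\<close>,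
  and for odd \<open>k\<close> the \<open>k\<close>-th one satisfies \<open>Q (P - e Q) = 1 / A\<close> with \<open>A = 2 k + 1 + O(1 / k)\<close>.
  Scaling it by an odd \<open>t\<close> yields \<open>q (p - e q) = t\<^sup>2 / A\<close>, so one needs an odd \<open>t\<close> with \<open>t\<^sup>2 / c\<close> close to
  \<open>2 k + 1\<close>; with \<open>t = 2 s + 1\<close> this asks that a quadratic polynomial in \<open>s\<close> with irrational
  leading coefficient \<open>1 / c\<close> be close to an integer. Weyl differencing, averaged over the
  frequencies by means of the divisor bound, gives distance \<open>s powr (- 1 / 2 + \<eta>)\<close> infinitely often.
  Since \<open>ln q\<close> is \<open>t\<^sup>2\<close> up to a logarithmic factor, this is the exponent \<open>1 + 1 / 4\<close>.
\<close>

section \<open>The divisor bound\<close>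

lemma card_divisors_mult_le:
  fixes m n :: nat
  assumes "m > 0" "n > 0"
  shows "card {d. d dvd m * n} \<le> card {d. d dvd m} * card {d. d dvd n}"
proof -
  have fin: "finite {d. d dvd m}" "finite {d. d dvd n}"
    using assms by (auto intro: finite_divisors_nat)
  have "{d. d dvd m * n} \<subseteq> (\<lambda>(a, b). a * b) ` ({d. d dvd m} \<times> {d. d dvd n})"
    by (auto dest!: division_decomp)
  then have "card {d. d dvd m * n} \<le> card ({d. d dvd m} \<times> {d. d dvd n})"
    using fin by (intro surj_card_le) auto
  then show ?thesis
    by (simp add: card_cartesian_product)
qed

lemma card_divisors_prime_power:
  fixes p :: nat
  assumes "prime p"
  shows "card {d. d dvd p ^ a} \<le> Suc a"
proof -
  have "{d. d dvd p ^ a} \<subseteq> (\<lambda>i. p ^ i) ` {..a}"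
    using assms by (auto simp: divides_primepow_nat)
  then have "card {d. d dvd p ^ a} \<le> card {..a}"
    by (intro surj_card_le) auto
  then show ?thesis by simp
qed

text \<open>A prime power factor \<open>p ^ a\<close> multiplies the number of divisors by at most \<open>a + 1\<close>,
  which is at most \<open>p powr (a * \<eta>)\<close> for all but finitely many primes \<open>p\<close>.\<close>
lemma card_divisors_le_powr:
  fixes \<eta> :: real
  assumes "\<eta> > 0"
  obtains C where "C > 0" "\<And>n::nat. n > 0 \<Longrightarrow> real (card {d. d dvd n}) \<le> C * real n powr \<eta>"
proof -
  \<comment> \<open>From \<open>B\<close> on, \<open>p powr \<eta>\<close> is at least 2, so
    \<open>Suc a \<le> 2 ^ a\<close> absorbs the divisor count of \<open>p ^ a\<close> without any
    constant.\<close>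
  define B where "B = nat \<lceil>2 powr (1 / \<eta>)\<rceil>"
  \<comment> \<open>For primes below \<open>B\<close> the constant pays:
    \<open>1 + a * \<eta> * ln 2 \<le> 2 powr (a * \<eta>)\<close>, and
    \<open>C * \<eta> * ln 2 \<ge> 1\<close> turns the left side, times \<open>C\<close>, into at
    least \<open>a + 1\<close>.\<close>
  define C :: real where "C = max 1 (1 / (\<eta> * ln 2))"
  have C1: "C \<ge> 1" by (simp add: C_def)
  have "C * (\<eta> * ln 2) \<ge> 1 / (\<eta> * ln 2) * (\<eta> * ln 2)"
    unfolding C_def using assms by (intro mult_right_mono) auto
  then have C2: "C * (\<eta> * ln 2) \<ge> 1" using assms by simp
  have big: "real p powr \<eta> \<ge> 2" if "p \<ge> B" for p
  proof -
    have "2 powr (1 / \<eta>) \<le> real p" using that unfolding B_def by linarith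
    then have "(2 powr (1 / \<eta>)) powr \<eta> \<le> real p powr \<eta>"
      using assms by (intro powr_mono2) auto
    then show ?thesis using assms by (simp add: powr_powr)
  qed
  have fac: "real (Suc a) \<le> (if p < B then C else 1) * real (p ^ a) powr \<eta>" if "prime p" for p a :: nat
  proof -
    have p2: "p \<ge> 2" using that prime_ge_2_nat by blast
    have eq: "real (p ^ a) powr \<eta> = (real p powr \<eta>) ^ a"
      using p2 by (simp add: powr_powr mult.commute flip: powr_realpow)
    show ?thesis
    proof (cases "p < B")
      case True
      have "1 + real a * (\<eta> * ln 2) \<le> exp (real a * (\<eta> * ln 2))"
        by (rule exp_ge_add_one_self)
      also have "\<dots> = (2 powr \<eta>) ^ a"
        by (simp add: powr_def exp_of_nat_mult)
      also have "\<dots> \<le> (real p powr \<eta>) ^ a"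
        using p2 assms by (intro power_mono powr_mono2) auto
      finally have "C * (1 + real a * (\<eta> * ln 2)) \<le> C * (real p powr \<eta>) ^ a"
        using C1 by (intro mult_left_mono) auto
      moreover have "real a * 1 \<le> real a * (C * (\<eta> * ln 2))"
        using C2 by (intro mult_left_mono) auto
      ultimately show ?thesis using True C1 eq by (simp add: algebra_simps)
    next
      case False
      have "Suc a \<le> 2 ^ a" by (induction a) auto
      then have "real (Suc a) \<le> 2 ^ a" by (metis of_nat_le_iff of_nat_numeral of_nat_power)
      also have "\<dots> \<le> (real p powr \<eta>) ^ a"
        using big[of p] False by (intro power_mono) auto
      finally show ?thesis using False eq by simp
    qed
  qed
  define S where "S = (\<lambda>n. {p. prime p \<and> p < B \<and> p dvd n})"
  have finS: "finite (S n)" for n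
    by (rule finite_subset[of _ "{..<B}"]) (auto simp: S_def)
  \<comment> \<open>The induction removes the full power of one prime, so the cofactor is prime to
    it and every small prime costs the factor \<open>C\<close> exactly once.\<close>
  have key: "real (card {d. d dvd n}) \<le> C ^ card (S n) * real n powr \<eta>" if "n > 0" for n
    using that
  proof (induction n rule: less_induct)
    case (less n)
    show ?case
    proof (cases "n = 1")
      case True
      have "C ^ card (S 1) \<ge> 1" using C1 by (simp add: one_le_power)
      then show ?thesis using True by simp
    next
      case False
      then obtain p where p: "prime p" "p dvd n" using prime_factor_nat by blast
      define a where "a = multiplicity p n"
      obtain m where m: "n = p ^ a * m" "\<not> p dvd m"
        unfolding a_def using less.prems p multiplicity_decompose' by (metis less_numeral_extra(3) not_prime_unit)
      have m0: "m > 0" using m less.prems by (cases "m = 0") auto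
      have a0: "a > 0" using m p by (cases "a = 0") auto
      have "p ^ a > 1" using p a0 by (metis one_less_power prime_gt_1_nat)
      then have "m < n" using m m0 by simp
      have pp: "x = p" if "prime x" "x dvd p ^ a" for x
        using that p(1) prime_dvd_power primes_dvd_imp_eq by blast
      have prime_dvd_iff: "prime x \<and> x dvd n \<longleftrightarrow> x = p \<or> prime x \<and> x dvd m" for x
        using pp[of x] p unfolding m(1) by (metis dvd_mult prime_dvd_mult_iff)
      have "S n = {x. x < B \<and> (prime x \<and> x dvd n)}"
        by (auto simp: S_def)
      also have "\<dots> = {x. x < B \<and> (x = p \<or> prime x \<and> x dvd m)}"
        by (simp only: prime_dvd_iff)
      also have "\<dots> = (if p < B then insert p (S m) else S m)"
        by (auto simp: S_def)
      finally have Sn: "S n = (if p < B then insert p (S m) else S m)" .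
      have pS: "p \<notin> S m" using m by (auto simp: S_def)
      have "card {d. d dvd n} \<le> Suc a * card {d. d dvd m}"
      proof -
        have "card {d. d dvd n} \<le> card {d. d dvd p ^ a} * card {d. d dvd m}"
          unfolding m(1) using p(1) m0 by (intro card_divisors_mult_le) (auto simp: prime_gt_0_nat)
        also have "\<dots> \<le> Suc a * card {d. d dvd m}"
          by (intro mult_le_mono1 card_divisors_prime_power p(1))
        finally show ?thesis .
      qed
      then have "real (card {d. d dvd n}) \<le> real (Suc a) * real (card {d. d dvd m})"
        by (metis of_nat_le_iff of_nat_mult)
      also have "\<dots> \<le> ((if p < B then C else 1) * real (p ^ a) powr \<eta>) * (C ^ card (S m) * real m powr \<eta>)"
        using less.IH[OF \<open>m < n\<close> m0] fac[OF p(1), of a] C1 by (intro mult_mono) auto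
      also have "\<dots> = C ^ card (S n) * real n powr \<eta>"
        using m pS finS Sn by (simp add: powr_mult)
      finally show ?thesis .
    qed
  qed
  show ?thesis
  proof (rule that[of "C ^ B"])
    show "C ^ B > 0" using C1 by simp
    fix n :: nat assume "n > 0"
    have "card (S n) \<le> card {..<B}" by (rule card_mono) (auto simp: S_def)
    then have "C ^ card (S n) \<le> C ^ B" using C1 by (intro power_increasing) auto
    then show "real (card {d. d dvd n}) \<le> C ^ B * real n powr \<eta>"
      using key[OF \<open>n > 0\<close>] by (meson mult_right_mono order_trans powr_ge_zero)
  qed
qed

section \<open>Exponential sums with quadratic phases\<close>

definition nint_dist :: "real \<Rightarrow> real" where
  "nint_dist x = \<bar>x - of_int (round x)\<bar>"

lemma nint_dist_nonneg: "nint_dist x \<ge> 0"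
  by (simp add: nint_dist_def)

lemma nint_dist_le_half: "nint_dist x \<le> 1 / 2"
  using of_int_round_abs_le[of x] by (simp add: nint_dist_def abs_minus_commute)

definition unit_exp :: "real \<Rightarrow> complex" where
  "unit_exp x = cis (2 * pi * x)"

lemma unit_exp_0 [simp]: "unit_exp 0 = 1"
  by (simp add: unit_exp_def)

lemma norm_unit_exp [simp]: "norm (unit_exp x) = 1"
  by (simp add: unit_exp_def)

lemma unit_exp_add: "unit_exp (x + y) = unit_exp x * unit_exp y"
  by (simp add: unit_exp_def cis_mult algebra_simps)

lemma cnj_unit_exp: "cnj (unit_exp x) = unit_exp (- x)"
  by (simp add: unit_exp_def cis_cnj)

lemma unit_exp_power: "unit_exp x ^ n = unit_exp (real n * x)"
  by (simp add: unit_exp_def Complex.DeMoivre algebra_simps)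

lemma unit_exp_diff_int: "unit_exp (x - of_int z) = unit_exp x"
  using cis_multiple_2pi[of "of_int (- z)"] unit_exp_add[of x "- of_int z"] by (simp add: unit_exp_def)

text \<open>Jordan's inequality: a concave function lies above its chord, here the one from 0 to
  \<open>pi / 2\<close>.\<close>

lemma sin_ge_linear:
  assumes "0 \<le> x" "x \<le> pi / 2"
  shows "sin x \<ge> 2 / pi * x"
proof -
  have "concave_on {0..pi} sin"
    unfolding concave_on_def
    by (rule f''_ge0_imp_convex[where f' = "\<lambda>x. - cos x" and f'' = sin])
       (auto intro!: derivative_eq_intros sin_ge_zero)
  then have "(1 - 2 / pi * x) * sin 0 + (2 / pi * x) * sin (pi / 2)
      \<le> sin ((1 - 2 / pi * x) *\<^sub>R 0 + (2 / pi * x) *\<^sub>R (pi / 2))"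
    using assms by (intro concave_onD) (auto simp: field_simps)
  then show ?thesis by simp
qed

text \<open>By periodicity \<open>x\<close> may be reduced to its signed distance from the nearest
  integer; the chord then has length twice a sine, to which Jordan's inequality applies.\<close>

lemma norm_one_minus_unit_exp_ge: "norm (1 - unit_exp x) \<ge> 4 * nint_dist x"
proof -
  let ?y = "x - of_int (round x)"
  have "norm (1 - unit_exp x) = norm (unit_exp ?y - 1)"
    by (simp add: unit_exp_diff_int norm_minus_commute)
  also have "\<dots> = norm (exp (\<i> * complex_of_real (2 * pi * ?y)) - 1)"
    by (simp add: unit_exp_def cis_conv_exp)
  also have "\<dots> = 2 * \<bar>sin (2 * pi * ?y / 2)\<bar>"
    by (rule dist_exp_i_1)
  also have "\<dots> = 2 * \<bar>sin \<bar>pi * ?y\<bar>\<bar>"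
    by (cases "pi * ?y \<ge> 0") (simp_all add: abs_if)
  also have "\<dots> \<ge> 2 * (2 / pi * \<bar>pi * ?y\<bar>)"
  proof -
    have "\<bar>?y\<bar> \<le> 1 / 2" using nint_dist_le_half[of x] by (simp add: nint_dist_def)
    then have "pi * \<bar>?y\<bar> \<le> pi * (1 / 2)" by (intro mult_left_mono) auto
    then have "\<bar>pi * ?y\<bar> \<le> pi / 2" by (simp add: abs_mult)
    then have "2 / pi * \<bar>pi * ?y\<bar> \<le> sin \<bar>pi * ?y\<bar>"
      by (intro sin_ge_linear) auto
    then show ?thesis by linarith
  qed
  finally show ?thesis by (simp add: nint_dist_def abs_mult)
qed

text \<open>The factor \<open>1 - unit_exp x\<close> telescopes the sum to a difference of norm at
  most 2. The product form also covers integral \<open>x\<close>.\<close>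

lemma norm_geometric_unit_exp_le:
  "norm (\<Sum>j<n. unit_exp (real j * x)) * nint_dist x \<le> 1"
proof -
  have "norm (\<Sum>j<n. unit_exp (real j * x)) * (4 * nint_dist x)
      \<le> norm (\<Sum>j<n. unit_exp (real j * x)) * norm (1 - unit_exp x)"
    by (intro mult_left_mono norm_one_minus_unit_exp_ge) auto
  also have "\<dots> = norm ((1 - unit_exp x) * (\<Sum>j<n. unit_exp x ^ j))"
    by (simp add: norm_mult unit_exp_power mult.commute)
  also have "\<dots> = norm (1 - unit_exp x ^ n)"
    by (simp add: one_diff_power_eq)
  also have "\<dots> \<le> norm (1::complex) + norm (unit_exp x ^ n)"
    by (rule norm_triangle_ineq4)
  also have "\<dots> = 2" by (simp add: norm_power)
  finally have "4 * (norm (\<Sum>j<n. unit_exp (real j * x)) * nint_dist x) \<le> 2"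
    by (simp add: algebra_simps)
  then show ?thesis by linarith
qed

text \<open>A rational substitute for \<open>min q (1 / nint_dist x)\<close>, within a factor 2 of it.\<close>
definition weyl_bound :: "real \<Rightarrow> real \<Rightarrow> real" where
  "weyl_bound q x = 2 * q / (1 + q * nint_dist x)"

lemma weyl_bound_nonneg: "q \<ge> 0 \<Longrightarrow> weyl_bound q x \<ge> 0"
  using nint_dist_nonneg[of x] by (simp add: weyl_bound_def)

text \<open>The trivial bound \<open>q\<close> and \<open>q\<close> times the geometric bound are
  added, which gives both regimes of the minimum in one inequality.\<close>

lemma norm_linear_sum_le:
  assumes "real n \<le> q"
  shows "norm (\<Sum>j<n. unit_exp (real j * x)) \<le> weyl_bound q x"
proof -
  let ?S = "norm (\<Sum>j<n. unit_exp (real j * x))"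
  have q: "q \<ge> 0" using assms by linarith
  have "?S \<le> (\<Sum>j<n. norm (unit_exp (real j * x)))" by (rule norm_sum)
  then have "?S \<le> q" using assms by simp
  moreover have "q * (?S * nint_dist x) \<le> q * 1"
    by (intro mult_left_mono norm_geometric_unit_exp_le q)
  ultimately have "?S * (1 + q * nint_dist x) \<le> 2 * q" by (simp add: algebra_simps)
  moreover have "1 + q * nint_dist x > 0"
    using nint_dist_nonneg[of x] q by (simp add: add_pos_nonneg)
  ultimately show ?thesis by (simp add: weyl_bound_def pos_le_divide_eq)
qed

section \<open>Weyl differencing\<close>

lemma sum_mult_cnj_shift:
  fixes z :: "nat \<Rightarrow> complex"
  shows "(norm (\<Sum>s<n. z s))\<^sup>2 =
    (\<Sum>s<n. (norm (z s))\<^sup>2) + 2 * Re (\<Sum>l=1..<n. \<Sum>s<n-l. z (s + l) * cnj (z s))"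
proof (induction n)
  case (Suc n)
  let ?S = "\<Sum>s<n. z s"
  \<comment> \<open>The new index \<open>n\<close> adds one term to each shift \<open>l\<close>,
    namely the pair \<open>n\<close> and \<open>n - l\<close>; the shifts \<open>l\<close> and
    \<open>- l\<close> are conjugate, hence twice the real part.\<close>
  have "(norm (\<Sum>s<Suc n. z s))\<^sup>2 = (norm ?S)\<^sup>2 + (norm (z n))\<^sup>2 + 2 * Re (z n * cnj ?S)"
  proof -
    have "(norm (u + v))\<^sup>2 = (norm u)\<^sup>2 + (norm v)\<^sup>2 + 2 * Re (v * cnj u)" for u v :: complex
      unfolding cmod_power2 by (simp add: power2_eq_square algebra_simps)
    then show ?thesis by (simp only: sum.lessThan_Suc)
  qed
  also have "z n * cnj ?S = (\<Sum>l=1..<Suc n. z n * cnj (z (n - l)))"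
    unfolding cnj_sum sum_distrib_left
    by (rule sum.reindex_bij_witness[of _ "\<lambda>l. n - l" "\<lambda>s. n - s"]) auto
  also have "(\<Sum>l=1..<Suc n. \<Sum>s<Suc n-l. z (s + l) * cnj (z s))
      = (\<Sum>l=1..<Suc n. (\<Sum>s<n-l. z (s + l) * cnj (z s)) + z n * cnj (z (n - l)))"
    by (intro sum.cong) (auto simp: Suc_diff_le)
  then have "(\<Sum>l=1..<Suc n. z n * cnj (z (n - l))) =
     (\<Sum>l=1..<Suc n. \<Sum>s<Suc n-l. z (s + l) * cnj (z s)) - (\<Sum>l=1..<n. \<Sum>s<n-l. z (s + l) * cnj (z s))"
    by (cases n) (simp_all add: sum.distrib)
  finally show ?case using Suc by (simp add: algebra_simps del: sum.op_ivl_Suc)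
qed simp

text \<open>Conjugation against a shift by \<open>l\<close> cancels the quadratic term in
  \<open>s\<close>. What remains is a linear phase of slope \<open>2 * \<alpha> * l\<close>;
  \<open>\<gamma>\<close> only enters a factor of modulus 1 and \<open>\<beta>\<close>
  disappears.\<close>

lemma weyl_differencing:
  fixes \<alpha> \<gamma> \<beta> :: real
  shows "(norm (\<Sum>s<n. unit_exp (\<alpha> * (real s)\<^sup>2 + \<gamma> * real s + \<beta>)))\<^sup>2
    \<le> real n + 2 * (\<Sum>l=1..<n. weyl_bound (real n) (2 * \<alpha> * real l))"
proof -
  let ?z = "\<lambda>s::nat. unit_exp (\<alpha> * (real s)\<^sup>2 + \<gamma> * real s + \<beta>)"
  have *: "norm (\<Sum>s<n-l. ?z (s + l) * cnj (?z s)) \<le> weyl_bound (real n) (2 * \<alpha> * real l)" for l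
  proof -
    have "?z (s + l) * cnj (?z s) = unit_exp (\<alpha> * (real l)\<^sup>2 + \<gamma> * real l) * unit_exp (real s * (2 * \<alpha> * real l))" for s
      unfolding cnj_unit_exp unit_exp_add[symmetric]
      by (rule arg_cong[of _ _ unit_exp]) (simp add: power2_eq_square algebra_simps)
    then have "norm (\<Sum>s<n-l. ?z (s + l) * cnj (?z s)) = norm (\<Sum>s<n-l. unit_exp (real s * (2 * \<alpha> * real l)))"
      by (simp add: sum_distrib_left[symmetric] norm_mult)
    also have "\<dots> \<le> weyl_bound (real n) (2 * \<alpha> * real l)"
      by (rule norm_linear_sum_le) simp
    finally show ?thesis .
  qed
  have "Re (\<Sum>l=1..<n. \<Sum>s<n-l. ?z (s + l) * cnj (?z s)) \<le> norm (\<Sum>l=1..<n. \<Sum>s<n-l. ?z (s + l) * cnj (?z s))"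
    by (rule complex_Re_le_cmod)
  also have "\<dots> \<le> (\<Sum>l=1..<n. weyl_bound (real n) (2 * \<alpha> * real l))"
    by (intro sum_norm_le *)
  finally show ?thesis unfolding sum_mult_cnj_shift by simp
qed

section \<open>Averaging the differenced sums over the frequencies\<close>

lemma sum_harm_eq: "(\<Sum>b<n. 1 / (real b + 1)) = harm n"
  by (simp add: harm_altdef inverse_eq_divide add.commute)

text \<open>Replacing \<open>\<alpha>\<close> by \<open>a / q\<close> moves \<open>q k \<alpha>\<close> by less than a unit along the block, and \<open>k a\<close>
  runs through all residues modulo \<open>q\<close>.\<close>
lemma weyl_bound_block:
  fixes \<alpha> :: real and a :: int and q k0 :: nat
  assumes q: "q > 0" and cop: "coprime a (int q)" and approx: "\<bar>\<alpha> - of_int a / real q\<bar> < 1 / (real q)\<^sup>2"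
  shows "(\<Sum>r<q. weyl_bound (real q) (\<alpha> * real (k0 + r))) \<le> 12 * real q * harm q"
proof -
  define c where "c = \<lfloor>real q * real k0 * \<alpha>\<rfloor>"
  \<comment> \<open>Modulo \<open>q\<close>, the integer \<open>b r\<close> represents
    \<open>q * \<alpha> * (k0 + r)\<close> up to a bounded error; \<open>c\<close> is the offset
    common to the block.\<close>
  define b where "b = (\<lambda>r::nat. nat ((c + int r * a) mod int q))"
  have b_lt: "b r < q" for r using q by (simp add: b_def nat_less_iff)
  have "inj_on b {..<q}"
  proof (rule inj_onI)
    fix r r' assume r: "r \<in> {..<q}" "r' \<in> {..<q}" "b r = b r'"
    then have "(c + int r * a) mod int q = (c + int r' * a) mod int q"
      using q by (simp add: b_def eq_nat_nat_iff)
    then have "int q dvd (c + int r * a) - (c + int r' * a)" by (simp add: mod_eq_dvd_iff)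
    then have "int q dvd (int r - int r') * a" by (simp add: algebra_simps)
    then have "int q dvd int r - int r'" using cop by (simp add: coprime_commute coprime_dvd_mult_left_iff)
    then show "r = r'" using r dvd_imp_le_int[of "int r - int r'" "int q"] by (cases "r = r'") auto
  qed
  moreover from this have "b ` {..<q} = {..<q}"
    using b_lt by (intro endo_inj_surj) auto
  ultimately have bij: "bij_betw b {..<q} {..<q}" by (simp add: bij_betw_def)
  \<comment> \<open>The distance of \<open>b r\<close> from the multiples of \<open>q\<close> is the
    smaller of \<open>b r\<close> and \<open>q - b r\<close>. Two reciprocals, one for each end of
    the residue range, replace this minimum.\<close>
  have main: "weyl_bound (real q) (\<alpha> * real (k0 + r)) \<le> 6 * real q * (1 / (real (b r) + 1) + 1 / (real (q - 1 - b r) + 1))"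
    if r: "r < q" for r
  proof -
    define x where "x = \<alpha> * real (k0 + r)"
    define m where "m = round x"
    define z where "z = (c + int r * a) div int q"
    have bz: "c + int r * a = int q * z + int (b r)"
      using q by (simp add: b_def z_def)
    define err where "err = real q * x - of_int (c + int r * a)"
    have err: "err = (real q * real k0 * \<alpha> - of_int c) + real r * (real q * \<alpha> - of_int a)"
      by (simp add: err_def x_def algebra_simps)
    have "\<bar>real q * \<alpha> - of_int a\<bar> = real q * \<bar>\<alpha> - of_int a / real q\<bar>"
    proof -
      have "real q * \<alpha> - of_int a = real q * (\<alpha> - of_int a / real q)"
        using q by (simp add: right_diff_distrib)
      then show ?thesis by (simp only: abs_mult abs_of_nat)
    qed
    also have "\<dots> \<le> real q * (1 / (real q)\<^sup>2)" using approx by (intro mult_left_mono) auto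
    also have "\<dots> = 1 / real q" by (simp add: power2_eq_square)
    finally have "real r * \<bar>real q * \<alpha> - of_int a\<bar> \<le> real q * (1 / real q)"
      using r by (intro mult_mono) auto
    then have "\<bar>real r * (real q * \<alpha> - of_int a)\<bar> \<le> 1" using q by (simp add: abs_mult)
    \<comment> \<open>The floor contributes between 0 and 1, and \<open>r < q\<close> steps with
      error below \<open>1 / q\<close> contribute at most 1 in absolute value.\<close>
    then have err_le: "- 1 \<le> err" "err \<le> 2" unfolding err c_def by linarith+
    have "real q * nint_dist x = \<bar>real q * x - real q * of_int m\<bar>"
      unfolding nint_dist_def m_def right_diff_distrib[symmetric] abs_mult by simp
    also have "real q * x - real q * of_int m = of_int (int q * (z - m) + int (b r)) + err"
      using bz by (simp add: err_def algebra_simps)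
    also have "\<bar>\<dots>\<bar> \<ge> of_int \<bar>int q * (z - m) + int (b r)\<bar> - 2" using err_le by linarith
    finally have d1: "real q * nint_dist x \<ge> of_int \<bar>int q * (z - m) + int (b r)\<bar> - 2" .
    have "\<bar>int q * (z - m) + int (b r)\<bar> \<ge> int (min (b r) (q - b r))"
    proof (cases "z - m \<ge> 0")
      case True
      then have "int q * (z - m) \<ge> 0" by simp
      then show ?thesis by linarith
    next
      case False
      then have "int q * (z - m) \<le> int q * (- 1)" by (intro mult_left_mono) auto
      then show ?thesis using b_lt[of r] by auto
    qed
    then have "real_of_int (int (min (b r) (q - b r))) \<le> of_int \<bar>int q * (z - m) + int (b r)\<bar>"
      by (simp only: of_int_le_iff)
    then have d: "real q * nint_dist x \<ge> real (min (b r) (q - b r)) - 2" using d1 by simp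
    have d0: "real q * nint_dist x \<ge> 0" using nint_dist_nonneg[of x] by simp
    \<comment> \<open>The loss of 2 caused by the error is traded for a factor 3, which keeps the
      denominator positive even for residues next to 0.\<close>
    have "1 + real q * nint_dist x \<ge> (real (min (b r) (q - b r)) + 1) / 3"
    proof -
      have "(M + 1) / 3 \<le> 1 + t" if "M - 2 \<le> t" "0 \<le> t" for M t :: real
        using that by (simp add: field_simps)
      then show ?thesis using d d0 .
    qed
    then have "weyl_bound (real q) x \<le> 2 * real q / ((real (min (b r) (q - b r)) + 1) / 3)"
      unfolding weyl_bound_def by (intro divide_left_mono) (use d0 in auto)
    also have "\<dots> = 6 * real q * (1 / (real (min (b r) (q - b r)) + 1))" by simp
    also have "1 / (real (min (b r) (q - b r)) + 1) \<le> 1 / (real (b r) + 1) + 1 / (real (q - 1 - b r) + 1)"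
    proof (cases "b r \<le> q - b r")
      case False
      have "1 / (real (q - b r) + 1) \<le> 1 / (real (q - 1 - b r) + 1)"
        by (intro divide_left_mono) auto
      then show ?thesis using False by (simp add: min_def add_nonneg_nonneg add_increasing)
    qed (simp add: min_def)
    finally show ?thesis using q by (simp add: x_def mult_left_mono)
  qed
  have "(\<Sum>r<q. weyl_bound (real q) (\<alpha> * real (k0 + r)))
      \<le> (\<Sum>r<q. 6 * real q * (1 / (real (b r) + 1) + 1 / (real (q - 1 - b r) + 1)))"
    by (intro sum_mono main) auto
  also have "\<dots> = (\<Sum>b<q. 6 * real q * (1 / (real b + 1) + 1 / (real (q - 1 - b) + 1)))"
    by (rule sum.reindex_bij_betw[OF bij])
  also have "\<dots> = 6 * real q * ((\<Sum>b<q. 1 / (real b + 1)) + (\<Sum>b<q. 1 / (real (q - 1 - b) + 1)))"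
    by (simp only: sum.distrib[symmetric] sum_distrib_left[symmetric])
  also have "(\<Sum>b<q. 1 / (real (q - 1 - b) + 1)) = (\<Sum>b<q. 1 / (real b + 1))"
    by (rule sum.reindex_bij_witness[of _ "\<lambda>b. q - 1 - b" "\<lambda>b. q - 1 - b"]) auto
  finally show ?thesis unfolding sum_harm_eq by simp
qed

lemma sum_weyl_bound_le:
  fixes \<alpha> :: real and a :: int and q M :: nat
  assumes "q > 0" "coprime a (int q)" "\<bar>\<alpha> - of_int a / real q\<bar> < 1 / (real q)\<^sup>2"
  shows "(\<Sum>k=1..M*q. weyl_bound (real q) (\<alpha> * real k)) \<le> real M * (12 * real q * harm q)"
proof (induction M)
  case (Suc M)
  have "{1..Suc M * q} = {1..M*q} \<union> {M*q+1..M*q+q}" by auto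
  then have "(\<Sum>k=1..Suc M*q. weyl_bound (real q) (\<alpha> * real k)) =
     (\<Sum>k=1..M*q. weyl_bound (real q) (\<alpha> * real k)) + (\<Sum>k=M*q+1..M*q+q. weyl_bound (real q) (\<alpha> * real k))"
    by (simp only:) (subst sum.union_disjoint, auto)
  also have "(\<Sum>k=M*q+1..M*q+q. weyl_bound (real q) (\<alpha> * real k)) = (\<Sum>r<q. weyl_bound (real q) (\<alpha> * real (M*q+1+r)))"
    by (rule sum.reindex_bij_witness[of _ "\<lambda>r. M*q+1+r" "\<lambda>k. k - (M*q+1)"]) auto
  finally show ?case using Suc weyl_bound_block[OF assms, of "M*q+1"] by (simp add: algebra_simps)
qed simp

text \<open>The pairs are grouped by \<open>k = 2 * h * l\<close>. Since \<open>h\<close> divides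
  \<open>k\<close> and determines \<open>l\<close>, each \<open>k\<close> occurs at most as often as
  it has divisors; this is where the divisor bound enters.\<close>

lemma sum_products_le:
  fixes g :: "nat \<Rightarrow> real" and D :: real
  assumes nonneg: "\<And>k. g k \<ge> 0"
    and D: "\<And>k. k > 0 \<Longrightarrow> k \<le> 2 * K * q \<Longrightarrow> real (card {d. d dvd k}) \<le> D"
  shows "(\<Sum>h=1..K. \<Sum>l=1..<q. g (2 * h * l)) \<le> D * (\<Sum>k=1..2*K*q. g k)"
proof -
  let ?P = "{1..K} \<times> {1..<q}"
  let ?f = "\<lambda>(h, l). 2 * h * l :: nat"
  have img: "?f ` ?P \<subseteq> {1..2*K*q}"
  proof
    fix k assume "k \<in> ?f ` ?P"
    then obtain h l where "k = 2 * h * l" "h \<in> {1..K}" "l \<in> {1..<q}" by auto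
    moreover from this have "h * l \<le> K * q" by (intro mult_le_mono) auto
    ultimately show "k \<in> {1..2*K*q}" by auto
  qed
  have card: "card {p \<in> ?P. ?f p = k} \<le> card {d. d dvd k}" if "k > 0" for k
  proof (rule card_inj_on_le[of fst])
    show "inj_on fst {p \<in> ?P. ?f p = k}" using that by (auto simp: inj_on_def)
    show "finite {d. d dvd k}" using that by (rule finite_divisors_nat)
  qed auto
  have "(\<Sum>h=1..K. \<Sum>l=1..<q. g (2 * h * l)) = (\<Sum>p\<in>?P. g (?f p))"
    by (simp add: sum.cartesian_product case_prod_unfold)
  also have "\<dots> = (\<Sum>k\<in>?f ` ?P. \<Sum>p\<in>{p\<in>?P. ?f p = k}. g (?f p))"
    by (rule sum.image_gen) auto
  also have "\<dots> = (\<Sum>k\<in>?f ` ?P. real (card {p \<in> ?P. ?f p = k}) * g k)"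
    by (intro sum.cong refl) simp
  also have "\<dots> \<le> (\<Sum>k\<in>?f ` ?P. D * g k)"
  proof (intro sum_mono mult_right_mono nonneg)
    fix k assume "k \<in> ?f ` ?P"
    then have k: "k > 0" "k \<le> 2 * K * q" using img by force+
    then show "real (card {p \<in> ?P. ?f p = k}) \<le> D"
      using card[of k] D[of k] by linarith
  qed
  also have "\<dots> \<le> (\<Sum>k=1..2*K*q. D * g k)"
  proof (rule sum_mono2)
    fix k assume k: "k \<in> {1..2*K*q} - ?f ` ?P"
    have "D \<ge> 0" using D[of k] k by (auto intro: order_trans[OF of_nat_0_le_iff])
    then show "0 \<le> D * g k" using nonneg by simp
  qed (use img in auto)
  finally show ?thesis by (simp add: sum_distrib_left)
qed

text \<open>Differencing each frequency leads to slopes \<open>2 * h * l\<close>, whose products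
  fill \<open>2 * K\<close> complete blocks of length \<open>q\<close>. Cauchy-Schwarz then passes
  from squares to the sum itself.\<close>

lemma sum_exponential_sums_le:
  fixes \<alpha> \<gamma> \<beta> :: real and a :: int and q K :: nat and D :: real
  assumes q: "q > 0" "coprime a (int q)" "\<bar>\<alpha> - of_int a / real q\<bar> < 1 / (real q)\<^sup>2"
    and D: "\<And>k. k > 0 \<Longrightarrow> k \<le> 2 * K * q \<Longrightarrow> real (card {d. d dvd k}) \<le> D" and D1: "D \<ge> 1"
  shows "(\<Sum>h=1..K. norm (\<Sum>s<q. unit_exp (real h * (\<alpha> * (real s)\<^sup>2 + \<gamma> * real s + \<beta>))))\<^sup>2
    \<le> 49 * (real K)\<^sup>2 * D * real q * harm q"
proof -
  define S where "S = (\<lambda>h::nat. norm (\<Sum>s<q. unit_exp (real h * (\<alpha> * (real s)\<^sup>2 + \<gamma> * real s + \<beta>))))"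
  have harm1: "harm q \<ge> (1::real)"
    using harm_mono[of 1 q, where ?'a = real] q(1) by (simp add: harm_def)
  have S: "(S h)\<^sup>2 \<le> real q + 2 * (\<Sum>l=1..<q. weyl_bound (real q) (\<alpha> * real (2 * h * l)))" for h
    using weyl_differencing[of "real h * \<alpha>" "real h * \<gamma>" "real h * \<beta>" q]
    by (simp add: S_def algebra_simps)
  have "(\<Sum>h=1..K. (S h)\<^sup>2) \<le> (\<Sum>h=1..K. real q + 2 * (\<Sum>l=1..<q. weyl_bound (real q) (\<alpha> * real (2 * h * l))))"
    by (intro sum_mono S)
  also have "\<dots> = real K * real q + 2 * (\<Sum>h=1..K. \<Sum>l=1..<q. weyl_bound (real q) (\<alpha> * real (2 * h * l)))"
    by (simp add: sum.distrib sum_distrib_left)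
  also have "\<dots> \<le> real K * real q + 2 * (D * (\<Sum>k=1..2*K*q. weyl_bound (real q) (\<alpha> * real k)))"
    using sum_products_le[of "\<lambda>k. weyl_bound (real q) (\<alpha> * real k)" K q D] D weyl_bound_nonneg by simp
  also have "\<dots> \<le> real K * real q + 2 * (D * (real (2 * K) * (12 * real q * harm q)))"
    using sum_weyl_bound_le[OF q, of "2 * K"] D1 by (intro add_mono mult_left_mono) auto
  \<comment> \<open>The off-diagonal part has the constant \<open>2 * 2 * 12 = 48\<close>; the
    diagonal term accounts for one more.\<close>
  also have "\<dots> \<le> 49 * real K * D * real q * harm q"
  proof -
    have "real K * real q * 1 \<le> real K * real q * (D * harm q)"
      using mult_mono[of 1 D 1 "harm q"] D1 harm1 by (intro mult_left_mono) auto
    then show ?thesis by (simp add: algebra_simps)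
  qed
  finally have *: "(\<Sum>h=1..K. (S h)\<^sup>2) \<le> 49 * real K * D * real q * harm q" .
  have "(\<Sum>h=1..K. S h)\<^sup>2 \<le> (\<Sum>h=1..K. (S h)\<^sup>2) * (\<Sum>h=1..K. 1\<^sup>2)"
    using Cauchy_Schwarz_ineq_sum[of S "\<lambda>_. 1" "{1..K}"] by simp
  also have "\<dots> \<le> (49 * real K * D * real q * harm q) * real K"
    using * by (simp add: mult_right_mono)
  finally show ?thesis by (simp add: S_def power2_eq_square algebra_simps)
qed

section \<open>From small exponential sums to a value close to an integer\<close>

lemma geometric_power_coeffs:
  obtains c :: "nat \<Rightarrow> real" and K where "K \<le> m * H" "\<And>k. c k \<ge> 0"
    "\<And>z::complex. (\<Sum>j<H. z ^ j) ^ m = (\<Sum>k\<le>K. of_real (c k) * z ^ k)"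
proof -
  \<comment> \<open>The coefficients of \<open>g\<close> are 0 or 1, so those of its powers are
    nonnegative reals.\<close>
  define g :: "complex poly" where "g = (\<Sum>j<H. monom 1 j)"
  have "Im (coeff g i) = 0 \<and> Re (coeff g i) \<ge> 0" for i
    by (auto simp: g_def coeff_sum intro!: sum_nonneg sum.neutral)
  then have nonneg: "Im (coeff (g ^ m) k) = 0 \<and> Re (coeff (g ^ m) k) \<ge> 0" for k
    by (induction m arbitrary: k)
       (auto simp: coeff_mult intro!: sum_nonneg sum.neutral)
  have deg: "degree (g ^ m) \<le> m * H"
  proof -
    have "degree g \<le> H"
      unfolding g_def by (intro degree_sum_le) (auto intro: order_trans[OF degree_monom_le])
    then show ?thesis
      using degree_power_le[of g m] by (metis le_trans mult.commute mult_le_mono2)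
  qed
  have eq: "(\<Sum>j<H. z ^ j) ^ m = (\<Sum>k\<le>degree (g ^ m). of_real (Re (coeff (g ^ m) k)) * z ^ k)" for z :: complex
  proof -
    have "(\<Sum>j<H. z ^ j) ^ m = poly (g ^ m) z"
      by (simp add: g_def poly_power poly_sum poly_monom)
    also have "\<dots> = (\<Sum>k\<le>degree (g ^ m). of_real (Re (coeff (g ^ m) k)) * z ^ k)"
      unfolding poly_altdef
      using nonneg by (intro sum.cong) (auto simp: complex_eq_iff)
    finally show ?thesis .
  qed
  show ?thesis
    using that[OF deg _ eq] nonneg by simp
qed

text \<open>The mean square of the polynomial over the points \<open>y s\<close> is dominated by its
  diagonal \<open>\<Sum>k\<le>K. (c k)\<^sup>2\<close>, which Cauchy-Schwarz compares with the
  squared value at 1. So some point attains a comparable value.\<close>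

lemma exists_large_trig_poly:
  fixes c y :: "nat \<Rightarrow> real" and N K :: nat
  assumes c: "\<And>k. c k \<ge> 0" and N: "N > 0"
    and small: "4 * (\<Sum>h=1..K. norm (\<Sum>s<N. unit_exp (real h * y s))) \<le> real N"
  obtains s where "s < N" "(\<Sum>k\<le>K. c k)\<^sup>2 \<le> 2 * real (K + 1) * (norm (\<Sum>k\<le>K. of_real (c k) * unit_exp (y s) ^ k))\<^sup>2"
proof (rule ccontr)
  let ?T = "\<lambda>s. norm (\<Sum>k\<le>K. of_real (c k) * unit_exp (y s) ^ k)"
  let ?C = "\<Sum>k\<le>K. (c k)\<^sup>2"
  define E where "E = (\<lambda>h::nat. \<Sum>s<N. unit_exp (real h * y s))"
  \<comment> \<open>The autocorrelation of the coefficients at shift \<open>h\<close>; it is the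
    weight of frequency \<open>h\<close> in the squared modulus and never exceeds the
    diagonal.\<close>
  define r where "r = (\<lambda>h. \<Sum>k<Suc K - h. c (k + h) * c k)"
  assume "\<not> thesis"
  then have lt: "\<forall>s<N. 2 * real (K + 1) * (?T s)\<^sup>2 < (\<Sum>k\<le>K. c k)\<^sup>2"
    using that by (meson not_le)
  have r: "0 \<le> r h" "r h \<le> ?C" for h
  proof -
    show "0 \<le> r h" using c by (simp add: r_def sum_nonneg)
    have "r h \<le> (\<Sum>k<Suc K - h. ((c (k + h))\<^sup>2 + (c k)\<^sup>2) / 2)"
      unfolding r_def
    proof (rule sum_mono)
      fix k
      show "c (k + h) * c k \<le> ((c (k + h))\<^sup>2 + (c k)\<^sup>2) / 2"
        using sum_squares_bound[of "c (k + h)" "c k"] by simp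
    qed
    also have "\<dots> = ((\<Sum>k<Suc K - h. (c (k + h))\<^sup>2) + (\<Sum>k<Suc K - h. (c k)\<^sup>2)) / 2"
      by (simp add: sum.distrib sum_divide_distrib add_divide_distrib)
    also have "(\<Sum>k<Suc K - h. (c (k + h))\<^sup>2) = (\<Sum>k\<in>{h..<Suc K}. (c k)\<^sup>2)"
      by (rule sum.reindex_bij_witness[of _ "\<lambda>k. k - h" "\<lambda>k. k + h"]) auto
    also have "\<dots> \<le> ?C" by (intro sum_mono2) auto
    also have "(\<Sum>k<Suc K - h. (c k)\<^sup>2) \<le> ?C" by (intro sum_mono2) auto
    finally show "r h \<le> ?C" by simp
  qed
  have T: "(?T s)\<^sup>2 = ?C + 2 * Re (\<Sum>h=1..K. of_real (r h) * unit_exp (real h * y s))" for s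
  proof -
    have cross: "of_real (c (k + h)) * unit_exp (y s) ^ (k + h) * cnj (of_real (c k) * unit_exp (y s) ^ k)
       = of_real (c (k + h) * c k) * unit_exp (real h * y s)" for k h
    proof -
      have "unit_exp (y s) ^ k * cnj (unit_exp (y s) ^ k) = 1"
        by (simp add: unit_exp_power cnj_unit_exp unit_exp_add[symmetric])
      moreover have "of_real (c (k + h)) * unit_exp (y s) ^ (k + h) * cnj (of_real (c k) * unit_exp (y s) ^ k)
        = of_real (c (k + h) * c k) * unit_exp (y s) ^ h * (unit_exp (y s) ^ k * cnj (unit_exp (y s) ^ k))"
        by (simp add: power_add)
      ultimately show ?thesis by (simp add: unit_exp_power)
    qed
    have "(?T s)\<^sup>2 = (norm (\<Sum>k<Suc K. of_real (c k) * unit_exp (y s) ^ k))\<^sup>2"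
      by (simp only: lessThan_Suc_atMost)
    also have "\<dots> = (\<Sum>k<Suc K. (norm (of_real (c k) * unit_exp (y s) ^ k))\<^sup>2)
        + 2 * Re (\<Sum>h=1..<Suc K. \<Sum>k<Suc K - h. of_real (c (k + h) * c k) * unit_exp (real h * y s))"
      unfolding sum_mult_cnj_shift cross ..
    also have "(\<Sum>k<Suc K. (norm (of_real (c k) * unit_exp (y s) ^ k))\<^sup>2) = ?C"
      unfolding lessThan_Suc_atMost by (simp add: norm_mult norm_power)
    also have "(\<Sum>h=1..<Suc K. \<Sum>k<Suc K - h. of_real (c (k + h) * c k) * unit_exp (real h * y s))
        = (\<Sum>h=1..K. of_real (r h) * unit_exp (real h * y s))"
      unfolding atLeastLessThanSuc_atLeastAtMost r_def of_real_sum sum_distrib_right ..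
    finally show ?thesis .
  qed
  have "(\<Sum>s<N. (?T s)\<^sup>2) = real N * ?C + 2 * Re (\<Sum>s<N. \<Sum>h=1..K. of_real (r h) * unit_exp (real h * y s))"
    unfolding T by (simp add: sum.distrib sum_distrib_left)
  also have "(\<Sum>s<N. \<Sum>h=1..K. of_real (r h) * unit_exp (real h * y s)) = (\<Sum>h=1..K. of_real (r h) * E h)"
    unfolding E_def sum_distrib_left by (rule sum.swap)
  finally have expand: "(\<Sum>s<N. (?T s)\<^sup>2) = real N * ?C + 2 * Re (\<Sum>h=1..K. of_real (r h) * E h)" .
  have Re_ge: "Re (\<Sum>h=1..K. of_real (r h) * E h) \<ge> - (\<Sum>h=1..K. r h * norm (E h))"
  proof -
    have "norm (\<Sum>h=1..K. of_real (r h) * E h) \<le> (\<Sum>h=1..K. r h * norm (E h))"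
      by (intro sum_norm_le) (simp add: norm_mult r)
    then show ?thesis using abs_Re_le_cmod[of "\<Sum>h=1..K. of_real (r h) * E h"] by linarith
  qed
  have "(\<Sum>h=1..K. r h * norm (E h)) \<le> (\<Sum>h=1..K. ?C * norm (E h))"
    by (intro sum_mono mult_right_mono r) auto
  also have "\<dots> = ?C * (\<Sum>h=1..K. norm (E h))" by (simp add: sum_distrib_left)
  also have "\<dots> \<le> ?C * (real N / 4)"
    using small by (intro mult_left_mono sum_nonneg) (auto simp: E_def)
  \<comment> \<open>The cross terms enter twice, each time with at most a quarter of
    \<open>real N * ?C\<close>, so half of the diagonal survives.\<close>
  finally have low: "real N * ?C / 2 \<le> (\<Sum>s<N. (?T s)\<^sup>2)"
    using expand Re_ge by (simp add: algebra_simps)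
  have "(\<Sum>k\<le>K. c k)\<^sup>2 \<le> ?C * real (K + 1)"
    using Cauchy_Schwarz_ineq_sum[of c "\<lambda>_. 1" "{..K}"] by simp
  then have "real N * (\<Sum>k\<le>K. c k)\<^sup>2 \<le> real N * (?C * real (K + 1))" by (intro mult_left_mono) auto
  also have "\<dots> = 2 * real (K + 1) * (real N * ?C / 2)" by simp
  also have "\<dots> \<le> 2 * real (K + 1) * (\<Sum>s<N. (?T s)\<^sup>2)" using low by (intro mult_left_mono) auto
  also have "\<dots> = (\<Sum>s<N. 2 * real (K + 1) * (?T s)\<^sup>2)" by (simp add: sum_distrib_left)
  also have "\<dots> < (\<Sum>s<N. (\<Sum>k\<le>K. c k)\<^sup>2)"
    using N lt by (intro sum_strict_mono) auto
  finally show False by simp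
qed

text \<open>The \<open>m\<close>-th power of a geometric sum equals \<open>H ^ m\<close> at 1 but is
  at most \<open>nint_dist (y s)\<close> to the power \<open>- m\<close> elsewhere, so a large value
  forces a small distance. Taking the power \<open>m\<close> makes the loss \<open>m * H + 1\<close>
  harmless after a root of order \<open>2 * m\<close>.\<close>

lemma exists_small_nint_dist:
  fixes y :: "nat \<Rightarrow> real" and N H m :: nat
  assumes N: "N > 0"
    and small: "4 * (\<Sum>h=1..m*H. norm (\<Sum>s<N. unit_exp (real h * y s))) \<le> real N"
  obtains s where "s < N" "(real H * nint_dist (y s)) ^ (2 * m) \<le> 2 * (real (m * H) + 1)"
proof -
  obtain c :: "nat \<Rightarrow> real" and K where K: "K \<le> m * H" and c: "\<And>k. c k \<ge> 0"
    and pow: "\<And>z::complex. (\<Sum>j<H. z ^ j) ^ m = (\<Sum>k\<le>K. of_real (c k) * z ^ k)"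
    by (rule geometric_power_coeffs[of m H]) (rule that)
  have "(\<Sum>h=1..K. norm (\<Sum>s<N. unit_exp (real h * y s))) \<le> (\<Sum>h=1..m*H. norm (\<Sum>s<N. unit_exp (real h * y s)))"
    using K by (intro sum_mono2) auto
  then have "4 * (\<Sum>h=1..K. norm (\<Sum>s<N. unit_exp (real h * y s))) \<le> real N" using small by linarith
  then obtain s where s: "s < N"
    "(\<Sum>k\<le>K. c k)\<^sup>2 \<le> 2 * real (K + 1) * (norm (\<Sum>k\<le>K. of_real (c k) * unit_exp (y s) ^ k))\<^sup>2"
    by (rule exists_large_trig_poly[OF c N])
  let ?D = "norm (\<Sum>j<H. unit_exp (real j * y s))" and ?d = "nint_dist (y s)"
  have "of_real (\<Sum>k\<le>K. c k) = (of_nat H ^ m :: complex)" using pow[of 1] by simp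
  then have "(\<Sum>k\<le>K. c k) = real H ^ m" by (metis of_real_eq_iff of_real_of_nat_eq of_real_power)
  then have "real H ^ (2 * m) \<le> 2 * real (K + 1) * ?D ^ (2 * m)"
    using s(2) unfolding pow[symmetric] by (simp add: unit_exp_power norm_power power_even_eq)
  also have "\<dots> \<le> 2 * (real (m * H) + 1) * ?D ^ (2 * m)"
    using of_nat_mono[OF K, where ?'a = real] by (intro mult_right_mono) auto
  finally have "real H ^ (2 * m) * ?d ^ (2 * m) \<le> 2 * (real (m * H) + 1) * ?D ^ (2 * m) * ?d ^ (2 * m)"
    using nint_dist_nonneg by (intro mult_right_mono) auto
  also have "\<dots> = 2 * (real (m * H) + 1) * (?D * ?d) ^ (2 * m)" by (simp add: power_mult_distrib)
  also have "\<dots> \<le> 2 * (real (m * H) + 1) * 1"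
    using norm_geometric_unit_exp_le nint_dist_nonneg by (intro mult_left_mono power_le_one) auto
  finally show ?thesis using s(1) that by (simp add: power_mult_distrib)
qed

text \<open>Irrationality supplies rational approximations with arbitrarily large denominator
  \<open>q\<close>, and the window from \<open>q\<close> to \<open>2 * q\<close> is searched with
  about \<open>q powr (1 / 2 - \<eta> / 2)\<close> frequencies.\<close>

lemma exists_quadratic_near_int:
  fixes \<alpha> \<beta> \<eta> :: real and S :: nat
  assumes irr: "\<alpha> \<notin> \<rat>" and \<eta>: "0 < \<eta>" "\<eta> < 1 / 2"
  obtains s :: nat where "s \<ge> S" "s > 0"
    "nint_dist (\<alpha> * ((real s)\<^sup>2 + real s) + \<beta>) \<le> real s powr (- 1 / 2 + \<eta>)"
proof -
  obtain C where C: "C > 0" "\<And>n::nat. n > 0 \<Longrightarrow> real (card {d. d dvd n}) \<le> C * real n powr (\<eta> / 4)"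
    using card_divisors_le_powr[of "\<eta> / 4"] \<eta> by auto
  \<comment> \<open>With this \<open>m\<close>, \<open>(q powr (\<eta> / 2)) ^ (2 * m)\<close> is at
    least \<open>q\<close>, which outgrows the loss \<open>m * H + 1\<close>.\<close>
  define m where "m = nat \<lceil>1 / \<eta>\<rceil>"
  have m: "real m * \<eta> \<ge> 1" "m > 0"
  proof -
    have "real m \<ge> 1 / \<eta>" unfolding m_def by linarith
    then show "real m * \<eta> \<ge> 1" using \<eta> by (simp add: field_simps)
    then show "m > 0" by (cases "m = 0") auto
  qed
  \<comment> \<open>The factor 784 is \<open>16 * 49\<close>: the inequality says that four times
    the sum of the exponential sums is at most \<open>q\<close>. The square of \<open>h\<close>
    leaves a saving \<open>q powr \<eta>\<close>, of which the divisor bound uses only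
    \<open>q powr (\<eta> / 2)\<close> up to a constant.\<close>
  have "eventually (\<lambda>x. 784 * (real m * x powr (1 / 2 - \<eta> / 2))\<^sup>2 * ((1 + C) * (2 * real m * x\<^sup>2) powr (\<eta> / 4)) * (1 + ln x) \<le> x) at_top"
    using C(1) m(2) \<eta> by real_asymp
  moreover have "eventually (\<lambda>x. 2 * (real m * x powr (1 / 2 - \<eta> / 2) + 1) < x / 16 ^ m) at_top"
  proof -
    have "eventually (\<lambda>x. 2 * (real m * x powr (1 / 2 - \<eta> / 2) + 1) < x / M) at_top" if "M > 0" for M :: real
      using that m(2) \<eta> by real_asymp
    from this[of "16 ^ m"] show ?thesis by simp
  qed
  moreover have "eventually (\<lambda>x. x \<ge> real S) at_top" "eventually (\<lambda>x::real. x \<ge> 1) at_top"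
    by (rule eventually_ge_at_top)+
  ultimately have "eventually (\<lambda>x. 784 * (real m * x powr (1 / 2 - \<eta> / 2))\<^sup>2 * ((1 + C) * (2 * real m * x\<^sup>2) powr (\<eta> / 4)) * (1 + ln x) \<le> x
      \<and> 2 * (real m * x powr (1 / 2 - \<eta> / 2) + 1) < x / 16 ^ m \<and> x \<ge> real S \<and> x \<ge> 1) at_top"
    by (intro eventually_conj)
  then obtain X where X: "\<And>x. x \<ge> X \<Longrightarrow> 784 * (real m * x powr (1 / 2 - \<eta> / 2))\<^sup>2 * ((1 + C) * (2 * real m * x\<^sup>2) powr (\<eta> / 4)) * (1 + ln x) \<le> x
      \<and> 2 * (real m * x powr (1 / 2 - \<eta> / 2) + 1) < x / 16 ^ m \<and> x \<ge> real S \<and> x \<ge> 1"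
    by (auto simp: eventually_at_top_linorder)
  obtain a k where ak: "(a, k) \<in> approx_set \<alpha>" "k > \<lceil>X\<rceil>"
    using infinite_approx_set[of \<alpha>] rational_iff_finite_approx_set[of \<alpha>] irr by blast
  define q where "q = nat k"
  have q: "q > 0" "coprime a (int q)" "\<bar>\<alpha> - of_int a / real q\<bar> < 1 / (real q)\<^sup>2" "real q \<ge> X"
    using ak by (auto simp: approx_set_def q_def) linarith
  define h where "h = real q powr (1 / 2 - \<eta> / 2)"
  define H where "H = nat \<lfloor>h\<rfloor>"
  have big: "784 * (real m * h)\<^sup>2 * ((1 + C) * (2 * real m * (real q)\<^sup>2) powr (\<eta> / 4)) * (1 + ln (real q)) \<le> real q"
    "2 * (real m * h + 1) < real q / 16 ^ m" "q \<ge> S" "real q \<ge> 1"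
    using X[OF q(4)] by (simp_all add: h_def)
  have h1: "h \<ge> 1" unfolding h_def using big(4) \<eta> by (intro ge_one_powr_ge_zero) auto
  have hq: "h \<le> real q" unfolding h_def using big(4) \<eta> powr_mono[of "1 / 2 - \<eta> / 2" 1 "real q"] by simp
  have H: "real H \<le> h" "h \<le> 2 * real H"
  proof -
    have "\<lfloor>h\<rfloor> \<ge> 1" using h1 by simp
    then have "real H = of_int \<lfloor>h\<rfloor>" "real_of_int \<lfloor>h\<rfloor> \<ge> 1" by (simp_all add: H_def)
    then show "real H \<le> h" "h \<le> 2 * real H" by linarith+
  qed
  define D where "D = (1 + C) * (2 * real m * (real q)\<^sup>2) powr (\<eta> / 4)"
  have D1: "D \<ge> 1"
  proof -
    have "1 * 1 \<le> 2 * real m * (real q)\<^sup>2" using m(2) big(4) by (intro mult_mono) auto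
    then have "(2 * real m * (real q)\<^sup>2) powr (\<eta> / 4) \<ge> 1" using \<eta> by (intro ge_one_powr_ge_zero) auto
    then have "1 * 1 \<le> D" unfolding D_def using C by (intro mult_mono) auto
    then show ?thesis by simp
  qed
  have D: "real (card {d. d dvd k}) \<le> D" if "k > 0" "k \<le> 2 * (m * H) * q" for k
  proof -
    have "real k \<le> real (2 * (m * H) * q)" using that by linarith
    also have "\<dots> = 2 * real m * (real H * real q)" by simp
    also have "\<dots> \<le> 2 * real m * (real q * real q)" using H(1) hq by (intro mult_left_mono mult_right_mono) auto
    finally have "real k powr (\<eta> / 4) \<le> (2 * real m * (real q)\<^sup>2) powr (\<eta> / 4)"
      using \<eta> by (intro powr_mono2) (auto simp: power2_eq_square)
    then have "C * real k powr (\<eta> / 4) \<le> D" unfolding D_def using C by (intro mult_mono) auto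
    then show ?thesis using C(2)[OF that(1)] by linarith
  qed
  \<comment> \<open>These are the coefficients after the substitution of \<open>q + s\<close> for
    \<open>s\<close>, which moves the range \<open>s < q\<close> to the window above
    \<open>q\<close>.\<close>
  define \<gamma>' where "\<gamma>' = 2 * \<alpha> * real q + \<alpha>"
  define \<beta>' where "\<beta>' = \<alpha> * ((real q)\<^sup>2 + real q) + \<beta>"
  define y where "y = (\<lambda>s::nat. \<alpha> * (real s)\<^sup>2 + \<gamma>' * real s + \<beta>')"
  define \<Sigma> where "\<Sigma> = (\<Sum>h=1..m*H. norm (\<Sum>s<q. unit_exp (real h * y s)))"
  have "(4 * \<Sigma>)\<^sup>2 \<le> 16 * (49 * (real (m * H))\<^sup>2 * D * real q * harm q)"
    using sum_exponential_sums_le[OF q(1-3) D D1, of "m * H" \<gamma>' \<beta>']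
    by (simp add: \<Sigma>_def y_def power_mult_distrib ac_simps)
  also have "\<dots> = 784 * (real m * real H)\<^sup>2 * D * harm q * real q" by (simp add: algebra_simps)
  also have "\<dots> \<le> 784 * (real m * h)\<^sup>2 * D * (1 + ln (real q)) * real q"
  proof -
    have "harm q \<le> 1 + ln (real q)"
      using decseqD[OF decseq_harm_diff_ln, of 0 "q - 1"] q(1) by (simp add: harm_def)
    then show ?thesis using H D1 harm_nonneg[of q, where ?'a = real]
      by (intro mult_mono power_mono mult_nonneg_nonneg) auto
  qed
  also have "\<dots> \<le> real q * real q"
    using big(1) by (intro mult_right_mono) (auto simp: D_def)
  finally have "(4 * \<Sigma>)\<^sup>2 \<le> (real q)\<^sup>2" by (simp add: power2_eq_square)
  then have "4 * \<Sigma> \<le> real q" by (rule power2_le_imp_le) simp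
  then obtain s where s: "s < q" "(real H * nint_dist (y s)) ^ (2 * m) \<le> 2 * (real (m * H) + 1)"
    unfolding \<Sigma>_def by (rule exists_small_nint_dist[OF q(1), where y = y])
  \<comment> \<open>The exponent is negative, so the endpoint \<open>2 * q\<close> gives a lower
    bound for the target throughout the window.\<close>
  define \<delta> where "\<delta> = (2 * real q) powr (- 1 / 2 + \<eta>)"
  have small: "nint_dist (y s) \<le> \<delta>"
  proof (rule ccontr)
    assume "\<not> ?thesis"
    then have "real H * \<delta> \<le> real H * nint_dist (y s)" by (intro mult_left_mono) auto
    moreover have "real q powr (\<eta> / 2) / 4 \<le> real H * \<delta>"
    proof -
      have "2 powr (-1) \<le> (2::real) powr (- 1 / 2 + \<eta>)" using \<eta> by (intro powr_mono) auto
      then have "(h / 2) * (1 / 2 * real q powr (- 1 / 2 + \<eta>)) \<le> real H * \<delta>"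
        unfolding \<delta>_def powr_mult[of 2] using H h1 by (intro mult_mono) (auto simp: powr_minus)
      moreover have "h * real q powr (- 1 / 2 + \<eta>) = real q powr (\<eta> / 2)"
        unfolding h_def powr_add[symmetric] by (rule arg_cong[of _ _ "\<lambda>e. real q powr e"]) (simp add: field_simps)
      ultimately show ?thesis by simp
    qed
    ultimately have "(real q powr (\<eta> / 2) / 4) ^ (2 * m) \<le> (real H * nint_dist (y s)) ^ (2 * m)"
      by (intro power_mono) auto
    also have "\<dots> \<le> 2 * (real (m * H) + 1)" by (rule s(2))
    also have "\<dots> \<le> 2 * (real m * h + 1)" using H by (simp add: mult_left_mono)
    also have "\<dots> < real q / 16 ^ m" by (rule big(2))
    also have "\<dots> \<le> (real q powr (\<eta> / 2) / 4) ^ (2 * m)"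
    proof -
      have "real q powr 1 \<le> real q powr (real m * \<eta>)" using big(4) m by (intro powr_mono) auto
      also have "real q powr (real m * \<eta>) = (real q powr (\<eta> / 2)) ^ (2 * m)"
        using q(1) by (simp add: powr_powr mult.commute flip: powr_realpow)
      finally have "real q \<le> (real q powr (\<eta> / 2)) ^ (2 * m)" by simp
      moreover have "(4::real) ^ (2 * m) = 16 ^ m" by (simp add: power_mult)
      ultimately show ?thesis by (simp add: power_divide divide_right_mono)
    qed
    finally show False by simp
  qed
  have "y s = \<alpha> * ((real (q + s))\<^sup>2 + real (q + s)) + \<beta>"
    by (simp add: y_def \<gamma>'_def \<beta>'_def power2_eq_square algebra_simps)
  moreover have "\<delta> \<le> real (q + s) powr (- 1 / 2 + \<eta>)"
    unfolding \<delta>_def using s(1) \<eta> q(1) by (intro powr_mono2') auto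
  ultimately show ?thesis using small big(3) q(1) by (intro that[of "q + s"]) auto
qed

section \<open>Pade approximants of the exponential function\<close>

text \<open>Numerators and denominators of the diagonal Pade approximants of \<open>exp\<close>, evaluated at \<open>1\<close>.\<close>
fun pade_num :: "nat \<Rightarrow> nat" where
  "pade_num 0 = 1"
| "pade_num (Suc 0) = 3"
| "pade_num (Suc (Suc n)) = (4 * n + 6) * pade_num (Suc n) + pade_num n"

fun pade_den :: "nat \<Rightarrow> nat" where
  "pade_den 0 = 1"
| "pade_den (Suc 0) = 1"
| "pade_den (Suc (Suc n)) = (4 * n + 6) * pade_den (Suc n) + pade_den n"

lemma odd_pade_num: "odd (pade_num n)"
  by (induction n rule: pade_num.induct) auto

lemma odd_pade_den: "odd (pade_den n)"
  by (induction n rule: pade_den.induct) auto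

lemma pade_den_pos: "pade_den n > 0"
  using odd_pade_den[of n] by (cases "pade_den n") auto

lemma pade_num_pos: "pade_num n > 0"
  using odd_pade_num[of n] by (cases "pade_num n") auto

lemma pade_den_mono: "pade_den n \<le> pade_den (Suc n)"
  by (cases n) (auto simp: trans_le_add1)

lemma pade_den_Suc_ge: "n > 0 \<Longrightarrow> (4 * n + 2) * pade_den n \<le> pade_den (Suc n)"
  by (cases n) (auto simp: algebra_simps)

lemma pade_den_Suc_le: "pade_den (Suc n) \<le> (4 * n + 3) * pade_den n"
proof (cases n)
  case (Suc m)
  then show ?thesis using pade_den_mono[of m] by (simp add: algebra_simps)
qed auto

text \<open>A crude growth rate, but enough: with \<open>k\<close> of order \<open>t\<^sup>2\<close>
  it makes the error \<open>C / Q\<close> of order \<open>t\<close> to the power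
  \<open>- 4\<close>.\<close>

lemma pade_den_ge_square: "n\<^sup>2 \<le> pade_den n"
proof (induction n)
  case (Suc n)
  show ?case
  proof (cases "n = 0")
    case False
    have "(Suc n)\<^sup>2 \<le> (4 * n + 2) * n\<^sup>2"
    proof -
      have "n * n \<ge> n" "n \<ge> 1" "n * (n * n) \<ge> n * n"
        using False by (auto simp: Suc_le_eq)
      moreover have "(4 * n + 2) * n\<^sup>2 = 4 * (n * (n * n)) + 2 * (n * n)" "(Suc n)\<^sup>2 = n * n + 2 * n + 1"
        by (simp_all add: power2_eq_square algebra_simps)
      ultimately show ?thesis by linarith
    qed
    also have "\<dots> \<le> (4 * n + 2) * pade_den n" using Suc by (rule mult_le_mono2)
    also have "\<dots> \<le> pade_den (Suc n)" using pade_den_Suc_ge[of n] False by auto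
    finally show ?thesis .
  qed auto
qed auto

lemma ln_pade_den_le: "ln (real (pade_den n)) \<le> real n * ln (4 * real n + 3)"
proof -
  \<comment> \<open>Fixing the base at \<open>N\<close> lets the induction multiply equal
    factors.\<close>
  have "pade_den n \<le> (4 * N + 3) ^ n" if "n \<le> N" for n N
    using that
  proof (induction n)
    case (Suc n)
    have "pade_den (Suc n) \<le> (4 * n + 3) * pade_den n" by (rule pade_den_Suc_le)
    also have "\<dots> \<le> (4 * N + 3) * (4 * N + 3) ^ n" using Suc by (intro mult_le_mono) auto
    finally show ?case by simp
  qed auto
  from this[of n n] have "real (pade_den n) \<le> (4 * real n + 3) ^ n"
    by (metis (mono_tags, lifting) le_refl of_nat_add of_nat_le_iff of_nat_mult of_nat_numeral of_nat_power)
  then have "ln (real (pade_den n)) \<le> ln ((4 * real n + 3) ^ n)"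
    using pade_den_pos[of n] by (subst ln_le_cancel_iff) auto
  then show ?thesis by (simp add: ln_realpow)
qed

lemma pade_det:
  "real (pade_num (Suc n)) * real (pade_den n) - real (pade_num n) * real (pade_den (Suc n)) = 2 * (-1) ^ n"
proof (induction n)
  case (Suc n)
  then show ?case by (simp add: algebra_simps)
qed simp

text \<open>Hermite's integral for the remainder of the Pade approximant. Division by the factorial
  normalises it so that, up to alternating signs, it obeys the recurrence of \<open>pade_num\<close>
  and \<open>pade_den\<close>.\<close>

definition pade_err :: "nat \<Rightarrow> real" where
  "pade_err n = integral {0..1} (\<lambda>x. (x * (1 - x)) ^ n * exp x) / fact n"

lemma pade_err_integral:
  "((\<lambda>x. (x * (1 - x)) ^ n * exp x) has_integral fact n * pade_err n) {0..1}"
proof -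
  have "(\<lambda>x::real. (x * (1 - x)) ^ n * exp x) integrable_on {0..1}"
    by (intro integrable_continuous_real continuous_intros)
  then show ?thesis by (simp add: pade_err_def integrable_integral)
qed

lemma pade_err_pos: "pade_err n > 0"
proof -
  have "integral {0..1} (\<lambda>x. (x * (1 - x)) ^ n * exp x) \<noteq> (0::real)"
  proof
    assume "integral {0..1} (\<lambda>x. (x * (1 - x)) ^ n * exp x) = (0::real)"
    moreover have "(\<lambda>x::real. (x * (1 - x)) ^ n * exp x) integrable_on {0..1}"
      by (intro integrable_continuous_real continuous_intros)
    ultimately have "((\<lambda>x::real. (x * (1 - x)) ^ n * exp x) has_integral 0) (cbox 0 1)"
      by (metis box_real(2) integrable_integral)
    then have "(1 / 2 * (1 - 1 / 2)) ^ n * exp (1 / 2) = (0::real)"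
      by (intro has_integral_0_cbox_imp_0[where x = "1/2::real"]) (auto intro!: continuous_intros)
    then show False by simp
  qed
  moreover have "integral {0..1} (\<lambda>x. (x * (1 - x)) ^ n * exp x) \<ge> (0::real)"
    by (intro integral_nonneg integrable_continuous_real continuous_intros) auto
  ultimately show ?thesis by (simp add: pade_err_def)
qed

text \<open>With \<open>u = x * (1 - x)\<close>, so that \<open>u'\<^sup>2 = 1 - 4 * u\<close>, the relation comes from integrating the derivative of
  \<open>(u ^ Suc (Suc n) - (n + 2) * u ^ Suc n * u') * exp x\<close>, which vanishes at both endpoints.\<close>
lemma pade_err_rec: "pade_err n = (4 * real n + 6) * pade_err (Suc n) + pade_err (Suc (Suc n))"
proof -
  let ?u = "\<lambda>x::real. x * (1 - x)"
  define G where "G = (\<lambda>x. (?u x ^ Suc (Suc n) - real (n + 2) * ?u x ^ Suc n * (1 - 2 * x)) * exp x)"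
  define g where "g = (\<lambda>x. ?u x ^ Suc (Suc n) * exp x
      + real (n + 2) * (4 * real n + 6) * (?u x ^ Suc n * exp x) - real (n + 2) * real (n + 1) * (?u x ^ n * exp x))"
  have "(G has_field_derivative g x) (at x)" for x
  proof -
    have u: "(?u has_field_derivative (1 - 2 * x)) (at x)"
      by (auto intro!: derivative_eq_intros simp: algebra_simps)
    have d: "((\<lambda>x. 1 - 2 * x) has_field_derivative - 2) (at x)"
      by (auto intro!: derivative_eq_intros)
    have "(G has_field_derivative
       ((1 + real (Suc n)) * ((1 - 2 * x) * ?u x ^ Suc n)
          - ((real (n + 2) * ((1 + real n) * ((1 - 2 * x) * ?u x ^ n))) * (1 - 2 * x)
              + (- 2) * (real (n + 2) * ?u x ^ Suc n))) * exp x
         + exp x * (?u x ^ Suc (Suc n) - real (n + 2) * ?u x ^ Suc n * (1 - 2 * x))) (at x)"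
      (is "(_ has_field_derivative ?D) _")
      unfolding G_def
      by (intro DERIV_mult DERIV_diff DERIV_cmult DERIV_power_Suc DERIV_exp u d)
    moreover have "?D = g x"
    proof -
      have "((1 + (1 + N)) * ((1 - 2 * x) * (?u x * w))
          - (((N + 2) * ((1 + N) * ((1 - 2 * x) * w))) * (1 - 2 * x) + (- 2) * ((N + 2) * (?u x * w)))) * E
         + E * (?u x * (?u x * w) - (N + 2) * (?u x * w) * (1 - 2 * x))
        = ?u x * (?u x * w) * E + (N + 2) * (4 * N + 6) * (?u x * w * E) - (N + 2) * (N + 1) * (w * E)" for N w E
        by algebra
      then show ?thesis
        unfolding g_def power_Suc of_nat_Suc of_nat_add of_nat_numeral of_nat_1 by this
    qed
    ultimately show ?thesis by simp
  qed
  then have "(g has_integral (G 1 - G 0)) {0..1}"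
    by (intro fundamental_theorem_of_calculus)
       (simp_all add: has_real_derivative_iff_has_vector_derivative[symmetric] has_field_derivative_at_within)
  moreover have "G 1 - G 0 = 0" by (simp add: G_def)
  moreover have "(g has_integral (fact (Suc (Suc n)) * pade_err (Suc (Suc n))
      + real (n + 2) * (4 * real n + 6) * (fact (Suc n) * pade_err (Suc n))
      - real (n + 2) * real (n + 1) * (fact n * pade_err n))) {0..1}"
    unfolding g_def
    by (intro has_integral_add has_integral_diff has_integral_mult_right pade_err_integral)
  ultimately have "fact (Suc (Suc n)) * pade_err (Suc (Suc n))
      + real (n + 2) * (4 * real n + 6) * (fact (Suc n) * pade_err (Suc n))
      - real (n + 2) * real (n + 1) * (fact n * pade_err n) = 0"
    by (metis has_integral_unique)
  then have "fact (Suc (Suc n)) * (pade_err (Suc (Suc n)) + (4 * real n + 6) * pade_err (Suc n) - pade_err n) = 0"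
    by (simp add: algebra_simps)
  then show ?thesis by simp
qed

lemma pade_err_0: "pade_err 0 = exp 1 - 1"
proof -
  have "(exp has_integral (exp 1 - exp 0)) {0..1::real}"
    by (intro fundamental_theorem_of_calculus)
       (auto simp: has_real_derivative_iff_has_vector_derivative[symmetric] intro!: derivative_eq_intros)
  then show ?thesis by (simp add: pade_err_def integral_unique)
qed

lemma pade_err_1: "pade_err (Suc 0) = 3 - exp 1"
proof -
  define G :: "real \<Rightarrow> real" where "G = (\<lambda>x. (- x\<^sup>2 + 3 * x - 3) * exp x)"
  have "(G has_field_derivative (x * (1 - x)) ^ Suc 0 * exp x) (at x)" for x
    unfolding G_def by (auto intro!: derivative_eq_intros simp: algebra_simps power2_eq_square)
  then have "((\<lambda>x. (x * (1 - x)) ^ Suc 0 * exp x) has_integral (G 1 - G 0)) {0..1}"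
    by (intro fundamental_theorem_of_calculus)
       (simp_all add: has_real_derivative_iff_has_vector_derivative[symmetric] has_field_derivative_at_within)
  then show ?thesis by (simp add: pade_err_def integral_unique G_def)
qed

text \<open>Both sides satisfy the same three-term recurrence, and the cases 0 and 1 are the
  integrals \<open>exp 1 - 1\<close> and \<open>3 - exp 1\<close>.\<close>

lemma pade_err_eq: "real (pade_num n) - exp 1 * real (pade_den n) = (-1) ^ Suc n * pade_err n"
proof (induction n rule: pade_num.induct)
  case (3 n)
  have "real (pade_num (Suc (Suc n))) - exp 1 * real (pade_den (Suc (Suc n)))
     = (4 * real n + 6) * (real (pade_num (Suc n)) - exp 1 * real (pade_den (Suc n)))
        + (real (pade_num n) - exp 1 * real (pade_den n))"
    by (simp add: algebra_simps)
  also have "\<dots> = (-1) ^ n * ((4 * real n + 6) * pade_err (Suc n) - pade_err n)"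
    unfolding 3 by (simp add: algebra_simps)
  also have "\<dots> = (-1) ^ Suc (Suc (Suc n)) * pade_err (Suc (Suc n))"
    using pade_err_rec[of n] by (simp add: algebra_simps)
  finally show ?case .
qed (auto simp: pade_err_0 pade_err_1)

text \<open>The reciprocal of the scaled error is half of the tail \<open>[4n+2; 4n-2, \<dots>] + [0; 4n+6, \<dots>]\<close>
  of the continued fraction with partial quotients \<open>4n+2\<close>.\<close>
lemma pade_product_bounds:
  assumes "n > 0"
  shows "2 * real n + 1 \<le> 1 / (real (pade_den n) * pade_err n)"
    and "1 / (real (pade_den n) * pade_err n) \<le> 2 * real n + 1 + 1 / real n"
proof -
  obtain m where m: "n = Suc m" using assms by (cases n) auto
  let ?Q = "\<lambda>n. real (pade_den n)"
  \<comment> \<open>Replacing numerators by errors in the determinant identity eliminates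
    \<open>exp 1\<close> and leaves a relation between denominators and errors only.\<close>
  have "(-1) ^ n * (?Q (Suc n) * pade_err n + ?Q n * pade_err (Suc n)) =
     (real (pade_num (Suc n)) - exp 1 * ?Q (Suc n)) * ?Q n - (real (pade_num n) - exp 1 * ?Q n) * ?Q (Suc n)"
    unfolding pade_err_eq by (simp add: algebra_simps)
  also have "\<dots> = 2 * (-1) ^ n"
    using pade_det[of n] by (simp add: algebra_simps)
  finally have *: "?Q (Suc n) * pade_err n + ?Q n * pade_err (Suc n) = 2" by simp
  have pos: "?Q n * pade_err n > 0" "?Q m > 0" "pade_err (Suc n) > 0" "pade_err (Suc (Suc n)) > 0" "?Q n > 0" "pade_err n > 0"
    using pade_err_pos pade_den_pos by simp_all
  have Q: "?Q (Suc n) = (4 * real n + 2) * ?Q n + ?Q m" unfolding m by simp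
  have E: "pade_err n = (4 * real n + 6) * pade_err (Suc n) + pade_err (Suc (Suc n))" by (rule pade_err_rec)
  have "(4 * real n + 2) * (?Q n * pade_err n) \<le> 2"
  proof -
    have "?Q m * pade_err n > 0" "?Q n * pade_err (Suc n) > 0" using pos by simp_all
    then show ?thesis using * unfolding Q by (simp add: algebra_simps)
  qed
  then show "2 * real n + 1 \<le> 1 / (?Q n * pade_err n)"
    using pos(1) by (simp add: field_simps)
  \<comment> \<open>Neighbouring denominators and errors differ by a factor of at least
    \<open>n\<close>, so the two secondary terms of the relation cost at most \<open>2 / n\<close>
    times \<open>?Q n * pade_err n\<close>.\<close>
  have "real n * ?Q m \<le> ?Q n"
  proof (cases "m = 0")
    case False
    have "n * pade_den m \<le> (4 * m + 2) * pade_den m" using m by (intro mult_le_mono1) auto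
    also have "\<dots> \<le> pade_den n" using pade_den_Suc_ge[of m] False m by auto
    finally show ?thesis by (metis of_nat_le_iff of_nat_mult)
  qed (simp add: m)
  then have 1: "real n * ?Q m * pade_err n \<le> ?Q n * pade_err n" using pos by (intro mult_right_mono) auto
  have "real n * pade_err (Suc n) \<le> (4 * real n + 6) * pade_err (Suc n)" using pos by (intro mult_right_mono) auto
  also have "\<dots> \<le> pade_err n" using E pos(4) by linarith
  finally have "real n * pade_err (Suc n) \<le> pade_err n" .
  then have 2: "?Q n * (real n * pade_err (Suc n)) \<le> ?Q n * pade_err n" using pos by (intro mult_left_mono) auto
  have "real n * (?Q (Suc n) * pade_err n + ?Q n * pade_err (Suc n)) = (4 * real n + 2) * real n * (?Q n * pade_err n) + real n * ?Q m * pade_err n + ?Q n * (real n * pade_err (Suc n))"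
    unfolding Q by (simp add: algebra_simps)
  also have "\<dots> \<le> ((4 * real n + 2) * real n + 2) * (?Q n * pade_err n)"
    using 1 2 by (simp add: algebra_simps)
  finally have "2 * real n \<le> ((4 * real n + 2) * real n + 2) * (?Q n * pade_err n)" unfolding * by simp
  then show "1 / (?Q n * pade_err n) \<le> 2 * real n + 1 + 1 / real n"
    using pos(1) assms by (simp add: field_simps)
qed

section \<open>Blocks of the harmonic series\<close>

text \<open>Telescoping with a corrected midpoint rule: the logarithmic difference is
  \<open>1 / l + 1 / (12 * l ^ 3)\<close> up to higher order, and the difference of the terms
  \<open>1 / (6 * (2 * l - 1)\<^sup>2)\<close> cancels the cubic part.\<close>

lemma sum_inverse_asymptotics:
  obtains C :: real and N :: nat where "C > 0"
    "\<And>n m. N \<le> n \<Longrightarrow> n \<le> m \<Longrightarrow> \<bar>(\<Sum>l=n..m. 1 / real l) -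
       (ln (2 * real m + 1) + 1 / (6 * (2 * real m + 1)\<^sup>2) - (ln (2 * real n - 1) + 1 / (6 * (2 * real n - 1)\<^sup>2)))\<bar>
       \<le> C * real m / real n ^ 4"
proof -
  define F where "F = (\<lambda>l::nat. ln (2 * real l - 1) + 1 / (6 * (2 * real l - 1)\<^sup>2))"
  have "(\<lambda>l::nat. 1 / real l - (ln (2 * real l + 1) + 1 / (6 * (2 * real l + 1)\<^sup>2)
      - (ln (2 * real l - 1) + 1 / (6 * (2 * real l - 1)\<^sup>2)))) \<in> O(\<lambda>l. 1 / real l ^ 4)"
    by real_asymp
  then obtain C where C: "C > 0" "eventually (\<lambda>l::nat. norm (1 / real l - (ln (2 * real l + 1) + 1 / (6 * (2 * real l + 1)\<^sup>2)
      - (ln (2 * real l - 1) + 1 / (6 * (2 * real l - 1)\<^sup>2)))) \<le> C * norm (1 / real l ^ 4)) sequentially"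
    by (elim landau_o.bigE)
  then have "eventually (\<lambda>l. \<bar>1 / real l - (F (Suc l) - F l)\<bar> \<le> C / real l ^ 4) sequentially"
    by (simp add: F_def add.commute)
  then obtain N where N: "\<And>l. l \<ge> N \<Longrightarrow> \<bar>1 / real l - (F (Suc l) - F l)\<bar> \<le> C / real l ^ 4"
    by (auto simp: eventually_sequentially)
  show ?thesis
  proof (rule that[OF C(1)])
    fix n m :: nat assume nm: "max 1 N \<le> n" "n \<le> m"
    have "(\<Sum>l=n..m. F (Suc l) - F l) = F (Suc m) - F n"
      using nm by (intro sum_Suc_diff) auto
    then have "\<bar>(\<Sum>l=n..m. 1 / real l) - (F (Suc m) - F n)\<bar> = \<bar>\<Sum>l=n..m. 1 / real l - (F (Suc l) - F l)\<bar>"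
      by (simp add: sum_subtractf)
    also have "\<dots> \<le> (\<Sum>l=n..m. \<bar>1 / real l - (F (Suc l) - F l)\<bar>)" by (rule sum_abs)
    also have "\<dots> \<le> (\<Sum>l=n..m. C / real n ^ 4)"
    proof (rule sum_mono)
      fix l assume l: "l \<in> {n..m}"
      then have "\<bar>1 / real l - (F (Suc l) - F l)\<bar> \<le> C / real l ^ 4" using nm by (intro N) auto
      also have "\<dots> \<le> C / real n ^ 4"
        using l nm C(1) by (intro divide_left_mono power_mono) auto
      finally show "\<bar>1 / real l - (F (Suc l) - F l)\<bar> \<le> C / real n ^ 4" .
    qed
    also have "\<dots> = real (Suc m - n) * (C / real n ^ 4)" by simp
    also have "\<dots> \<le> real m * (C / real n ^ 4)"
      using nm C(1) by (intro mult_right_mono) auto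
    finally show "\<bar>(\<Sum>l=n..m. 1 / real l) -
       (ln (2 * real m + 1) + 1 / (6 * (2 * real m + 1)\<^sup>2) - (ln (2 * real n - 1) + 1 / (6 * (2 * real n - 1)\<^sup>2)))\<bar>
       \<le> C * real m / real n ^ 4"
      by (simp add: F_def algebra_simps)
  qed
qed

lemma sinh_1_eq: "sinh (1::real) = (exp 1 - exp (- 1)) / 2"
  by (simp add: sinh_def)

text \<open>Writing the Pade quotient as \<open>P / Q = e (1 + x)\<close>, the logarithm contributes \<open>x\<close> and the quadratic terms
  contribute \<open>- (1 - 1 / e\<^sup>2) / (6 t\<^sup>2 Q\<^sup>2)\<close>.\<close>
lemma harmonic_block_pade:
  obtains C :: real and N :: nat where "C > 0"
    "\<And>k t n m. odd k \<Longrightarrow> N \<le> k \<Longrightarrow> 2 * n = t * pade_den k + 1 \<Longrightarrow> 2 * m + 1 = t * pade_num k \<Longrightarrow>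
       (real t)\<^sup>2 * (real (pade_den k) * pade_err k) \<le> 1 \<Longrightarrow>
       \<bar>(\<Sum>l=n..m. 1 / real l) - 1\<bar> \<le>
         (\<bar>(real t)\<^sup>2 * (real (pade_den k) * pade_err k) - sinh 1 / 3\<bar> + C / real (pade_den k))
           / (real t * real (pade_den k))\<^sup>2"
proof -
  obtain C N where C: "C > 0" and CN:
    "\<And>n m. N \<le> n \<Longrightarrow> n \<le> m \<Longrightarrow> \<bar>(\<Sum>l=n..m. 1 / real l) -
       (ln (2 * real m + 1) + 1 / (6 * (2 * real m + 1)\<^sup>2) - (ln (2 * real n - 1) + 1 / (6 * (2 * real n - 1)\<^sup>2)))\<bar>
       \<le> C * real m / real n ^ 4"
    by (rule sum_inverse_asymptotics) (rule that)
  show ?thesis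
  proof (rule that)
    show "32 * C + 2 > 0" using C by simp
    fix k t n m :: nat
    assume k: "odd k" "max 2 N \<le> k" and n: "2 * n = t * pade_den k + 1" and m: "2 * m + 1 = t * pade_num k"
      and t: "(real t)\<^sup>2 * (real (pade_den k) * pade_err k) \<le> 1"
    define P where "P = real (pade_num k)"
    define Q where "Q = real (pade_den k)"
    define E where "E = pade_err k"
    define e :: real where "e = exp 1"
    define x where "x = E / (e * Q)"
    define p where "p = real t * P"
    define q where "q = real t * Q"
    have t1: "t \<ge> 1" using m by (cases t) auto
    have e: "2 \<le> e" "e \<le> 3" using exp_ge_add_one_self[of 1] exp_le by (simp_all add: e_def)
    have Qk: "Q \<ge> (real k)\<^sup>2"
      using of_nat_mono[OF pade_den_ge_square[of k], where ?'a = real] by (simp add: Q_def)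
    have "k * 2 \<le> k * k" using k by (intro mult_le_mono2) auto
    then have "real k * 2 \<le> (real k)\<^sup>2" by (metis of_nat_le_iff of_nat_mult of_nat_numeral power2_eq_square)
    then have Q: "Q \<ge> 2 * real k" "Q \<ge> 1" using Qk k by linarith+
    have E: "E > 0" by (simp add: E_def pade_err_pos)
    have QE: "Q * E \<le> 1"
    proof -
      have "1 * (Q * E) \<le> (real t)\<^sup>2 * (Q * E)"
        using t1 Q E by (intro mult_right_mono) auto
      then show ?thesis using t by (simp add: Q_def E_def)
    qed
    have "1 * E \<le> Q * E" using Q E by (intro mult_right_mono) auto
    then have E1: "E \<le> 1" using QE by simp
    \<comment> \<open>Odd \<open>k\<close> makes the sign of the error positive, so that
      \<open>x\<close> below is nonnegative.\<close>
    have P: "P = e * Q + E"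
      using pade_err_eq[of k] k(1) by (simp add: P_def Q_def E_def e_def)
    have Px: "P = e * Q * (1 + x)" using e Q by (simp add: P x_def field_simps)
    have x: "0 \<le> x" "x \<le> 1 / Q" "x \<le> 1"
    proof -
      show "0 \<le> x" using e Q E by (simp add: x_def)
      have "1 * Q \<le> e * Q" using e Q by (intro mult_right_mono) auto
      then show xQ: "x \<le> 1 / Q" unfolding x_def using Q E E1 by (intro frac_le) auto
      have "1 / Q \<le> 1" using Q by simp
      with xQ show "x \<le> 1" by (rule order_trans)
    qed
    have q: "q > 0" "Q \<le> q" using t1 Q by (simp_all add: q_def)
    have nq: "2 * real n - 1 = q" using arg_cong[OF n, of real] by (simp add: q_def Q_def)
    have mp: "2 * real m + 1 = p" using arg_cong[OF m, of real] by (simp add: p_def P_def)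
    have pq: "p = e * q * (1 + x)" by (simp add: p_def q_def Px)
    have p4: "q < p" "p \<le> 4 * q"
    proof -
      have "Q * 2 \<le> Q * e" using e Q by (intro mult_left_mono) auto
      moreover have "Q * e \<le> Q * 3" using e Q by (intro mult_left_mono) auto
      moreover have "P = Q * e + E" by (simp add: P mult.commute)
      ultimately have "Q < P" "P \<le> 4 * Q" using E E1 Q(2) by linarith+
      then show "q < p" "p \<le> 4 * q" using t1 by (simp_all add: p_def q_def)
    qed
    have "real n \<ge> real k" using nq q Q by linarith
    then have nN: "n \<ge> N" using k by simp
    have nm: "n \<le> m" using p4 nq mp by linarith
    have "C * real m / real n ^ 4 \<le> C * (2 * q) / (q / 2) ^ 4"
      using C q nq mp p4 by (intro frac_le mult_left_mono power_mono) auto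
    also have "\<dots> = 32 * C / q / q\<^sup>2" using q by (simp add: field_simps power2_eq_square power4_eq_xxxx)
    also have "\<dots> \<le> 32 * C / Q / q\<^sup>2" using q Q C by (intro divide_right_mono divide_left_mono) auto
    finally have err: "\<bar>(\<Sum>l=n..m. 1 / real l) - (ln p + 1 / (6 * p\<^sup>2) - (ln q + 1 / (6 * q\<^sup>2)))\<bar> \<le> 32 * C / Q / q\<^sup>2"
      using CN[OF nN nm] unfolding nq mp by linarith
    have lnp: "ln p = 1 + ln q + ln (1 + x)"
      unfolding pq using e q x by (simp add: ln_mult e_def)
    \<comment> \<open>The assumption on \<open>t\<close> gives \<open>q\<^sup>2 * E \<le> Q\<close>,
      hence \<open>x \<le> 1 / q\<^sup>2\<close>; the quadratic error of the logarithm is then of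
      order \<open>1 / Q\<close> relative to \<open>1 / q\<^sup>2\<close>.\<close>
    have lnx: "\<bar>ln (1 + x) - x\<bar> \<le> x / q\<^sup>2"
    proof -
      have "x\<^sup>2 = x * (E / (e * Q))" by (simp add: power2_eq_square x_def)
      also have "\<dots> \<le> x * (1 / q\<^sup>2)"
      proof (intro mult_left_mono x)
        have "q\<^sup>2 * E = ((real t)\<^sup>2 * (Q * E)) * Q" by (simp add: q_def power2_eq_square)
        also have "\<dots> \<le> 1 * Q" using t Q by (intro mult_right_mono) (auto simp: Q_def E_def)
        also have "\<dots> \<le> e * Q" using e Q by (intro mult_right_mono) auto
        finally show "E / (e * Q) \<le> 1 / q\<^sup>2" using e Q q by (simp add: field_simps)
      qed
      finally have "x\<^sup>2 \<le> x / q\<^sup>2" by simp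
      moreover have "ln (1 + x) \<le> x" using x by (intro ln_add_one_self_le_self) auto
      moreover have "x - x\<^sup>2 \<le> ln (1 + x)" using x by (intro ln_one_plus_pos_lower_bound) auto
      ultimately show ?thesis by linarith
    qed
    have invp: "\<bar>1 / p\<^sup>2 - 1 / (e\<^sup>2 * q\<^sup>2)\<bar> \<le> 2 * x / q\<^sup>2"
    proof -
      have eq: "1 / p\<^sup>2 - 1 / (e\<^sup>2 * q\<^sup>2) = (1 / (1 + x)\<^sup>2 - 1) * (1 / (e\<^sup>2 * q\<^sup>2))"
      proof -
        have "1 / (a * b) - 1 / a = (1 / b - 1) * (1 / a)" for a b :: real
          by (simp add: diff_divide_distrib mult.commute)
        then show ?thesis unfolding pq power_mult_distrib .
      qed
      have le1: "\<bar>1 / (1 + x)\<^sup>2 - 1\<bar> \<le> 2 * x"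
      proof -
        have "1 / (1 + x)\<^sup>2 \<le> 1" using x by simp
        moreover have "1 - 2 * x \<le> 1 / (1 + x)\<^sup>2"
        proof -
          have "(1 - 2 * x) * (1 + x)\<^sup>2 = 1 - 3 * x\<^sup>2 - 2 * (x * x\<^sup>2)" by (simp add: power2_eq_square algebra_simps)
          also have "\<dots> \<le> 1"
            using x mult_nonneg_nonneg[of x "x\<^sup>2"] zero_le_power2[of x] by linarith
          finally show ?thesis using x by (simp add: pos_le_divide_eq)
        qed
        ultimately show ?thesis by linarith
      qed
      have le2: "\<bar>1 / (e\<^sup>2 * q\<^sup>2)\<bar> \<le> 1 / (1 * q\<^sup>2)"
        unfolding abs_of_nonneg[OF divide_nonneg_nonneg[OF zero_le_one mult_nonneg_nonneg[OF zero_le_power2 zero_le_power2]]]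
        using e q by (intro divide_left_mono mult_right_mono one_le_power) auto
      have "\<bar>1 / p\<^sup>2 - 1 / (e\<^sup>2 * q\<^sup>2)\<bar> \<le> 2 * x * (1 / (1 * q\<^sup>2))"
        unfolding eq abs_mult using le1 le2 x by (intro mult_mono) auto
      then show ?thesis by simp
    qed
    define M where "M = (real t)\<^sup>2 * (Q * E) - sinh 1 / 3"
    \<comment> \<open>Here \<open>x\<close> equals
      \<open>t\<^sup>2 * Q * E / (e * q\<^sup>2)\<close>, and \<open>(1 - 1 / e\<^sup>2) / 6\<close>
      equals \<open>sinh 1 / (3 * e)\<close>; this is the origin of the constant
      \<open>sinh 1 / 3\<close>.\<close>
    have eqM: "x - 1 / q\<^sup>2 / 6 + 1 / (e\<^sup>2 * q\<^sup>2) / 6 = M / e / q\<^sup>2"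
    proof -
      have sinh: "sinh (1::real) = (e - 1 / e) / 2"
        by (simp add: sinh_1_eq e_def exp_minus inverse_eq_divide)
      show ?thesis
        unfolding M_def sinh x_def q_def using e(1) Q(2) t1 by (simp add: field_simps power2_eq_square)
    qed
    have absM: "\<bar>M / e / q\<^sup>2\<bar> \<le> \<bar>M\<bar> / q\<^sup>2"
    proof -
      have "\<bar>M\<bar> / e \<le> \<bar>M\<bar> / 1" using e by (intro divide_left_mono) auto
      then have "\<bar>M\<bar> / e / q\<^sup>2 \<le> \<bar>M\<bar> / 1 / q\<^sup>2" by (intro divide_right_mono) auto
      then show ?thesis using e by simp
    qed
    have combine: "\<bar>z - 1\<bar> \<le> m + c + d + f / 6"
      if "v - a / 6 + b / 6 = u" "\<bar>u\<bar> \<le> m" "\<bar>z - (1 + g + h + r / 6 - (g + a / 6))\<bar> \<le> c"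
        "\<bar>h - v\<bar> \<le> d" "\<bar>r - b\<bar> \<le> f" for z m c d f v a b u g h r :: real
      using that by linarith
    have "1 / (6 * y) = 1 / y / 6" for y :: real by simp
    then have "\<bar>(\<Sum>l=n..m. 1 / real l) - (1 + ln q + ln (1 + x) + 1 / p\<^sup>2 / 6 - (ln q + 1 / q\<^sup>2 / 6))\<bar> \<le> 32 * C / Q / q\<^sup>2"
      using err unfolding lnp by simp
    then have "\<bar>(\<Sum>l=n..m. 1 / real l) - 1\<bar> \<le> \<bar>M\<bar> / q\<^sup>2 + 32 * C / Q / q\<^sup>2 + x / q\<^sup>2 + 2 * x / q\<^sup>2 / 6"
      by (rule combine[OF eqM absM _ lnx invp])
    also have "\<dots> \<le> (\<bar>M\<bar> + (32 * C + 2) / Q) / q\<^sup>2"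
    proof -
      have "x + 2 * x / 6 \<le> 2 / Q" using x by simp
      then have "(x + 2 * x / 6) / q\<^sup>2 \<le> (2 / Q) / q\<^sup>2" by (intro divide_right_mono) auto
      then show ?thesis by (simp add: add_divide_distrib)
    qed
    finally show "\<bar>(\<Sum>l=n..m. 1 / real l) - 1\<bar> \<le>
         (\<bar>(real t)\<^sup>2 * (real (pade_den k) * pade_err k) - sinh 1 / 3\<bar> + (32 * C + 2) / real (pade_den k))
           / (real t * real (pade_den k))\<^sup>2"
      by (simp add: M_def q_def Q_def E_def)
  qed
qed

section \<open>Irrationality of \<open>sinh 1\<close>, by the factorial argument used for
  \<open>e\<close>\<close>

lemma sinh_1_irrational: "sinh (1::real) \<notin> \<rat>"
proof
  assume "sinh (1::real) \<in> \<rat>"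
  then obtain a b :: int where ab: "b > 0" "sinh (1::real) = of_int a / of_int b"
    by (elim Rats_cases') auto
  define n where "n = nat b"
  have n: "n > 0" "real n = of_int b" using ab by (auto simp: n_def)
  define f where "f = (\<lambda>k. if even k then 0 else inverse (fact k) :: real)"
  have f: "f sums sinh 1"
    using sinh_converges[of "1::real"] by (simp add: f_def inverse_eq_divide cong: if_cong)
  \<comment> \<open>The denominator \<open>n\<close> divides the factorial of
    \<open>N - 1 = 2 * n\<close>, and \<open>N\<close> is odd, so the tail starts with a positive
    term. Multiplied by that factorial, the tail would be an integer strictly between 0 and
    1.\<close>
  define N where "N = 2 * n + 1"
  define r where "r = sinh 1 - (\<Sum>k<N. f k)"
  have tail: "(\<lambda>k. f (k + N)) sums r"
    unfolding r_def using f by (simp add: sums_iff_shift)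
  have rpos: "r > 0"
  proof -
    have "(\<Sum>k. f (k + N)) > 0"
      using tail by (intro suminf_pos2[where i = 0]) (auto simp: sums_iff f_def N_def)
    then show ?thesis using tail by (simp add: sums_iff)
  qed
  have bound: "f (k + N) \<le> inverse (fact N) * (1 / 2) ^ k" for k
  proof -
    have "fact N * 2 ^ k \<le> (fact (k + N) :: real)"
    proof (induction k)
      case (Suc k)
      have "fact N * 2 ^ Suc k = 2 * (fact N * 2 ^ k :: real)" by simp
      also have "\<dots> \<le> real (Suc (k + N)) * fact (k + N)"
        using Suc n by (intro mult_mono) (auto simp: N_def)
      finally show ?case by simp
    qed simp
    then have "inverse (fact (k + N)) \<le> inverse (fact N * 2 ^ k :: real)"
      by (intro le_imp_inverse_le) auto
    then show ?thesis by (auto simp: f_def power_one_over inverse_eq_divide)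
  qed
  have "r \<le> inverse (fact N) * 2"
  proof (rule sums_le[OF _ tail])
    show "(\<lambda>k. inverse (fact N) * (1 / 2) ^ k) sums (inverse (fact N) * 2 :: real)"
      by (intro sums_mult) (use geometric_sums[of "1/2::real"] in simp)
  qed (rule bound)
  then have "fact (N - 1) * r \<le> fact (N - 1) * (inverse (fact N) * 2)" by simp
  also have "\<dots> = 2 / real N"
  proof -
    have "fact N = real N * fact (N - 1)" by (simp add: N_def fact_reduce)
    then show ?thesis by (simp add: divide_simps)
  qed
  also have "\<dots> < 1" using n by (simp add: N_def)
  finally have lt: "fact (N - 1) * r < 1" .
  have "fact (N - 1) * r \<in> \<int>"
  proof -
    have 1: "fact (N - 1) * sinh (1::real) \<in> \<int>"
    proof -
      have "n dvd fact (N - 1)" using n by (intro dvd_fact) (auto simp: N_def)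
      then obtain c where "(fact (N - 1) :: nat) = n * c" by (elim dvdE)
      then have "(fact (N - 1) :: real) = real n * real c" by (metis of_nat_fact of_nat_mult)
      then have "fact (N - 1) * sinh (1::real) = of_int (int c * a)"
        using ab n by simp
      then show ?thesis by (metis Ints_of_int)
    qed
    have 2: "fact (N - 1) * (\<Sum>k<N. f k) \<in> \<int>"
      unfolding sum_distrib_left
    proof (intro Ints_sum)
      fix k assume "k \<in> {..<N}"
      then have "(fact k :: nat) dvd fact (N - 1)" by (intro fact_dvd) auto
      then obtain c where "(fact (N - 1) :: nat) = fact k * c" by (elim dvdE)
      then have "(fact (N - 1) :: real) = fact k * real c" by (metis of_nat_fact of_nat_mult)
      then have "fact (N - 1) * f k = (if even k then 0 else real c)" by (simp add: f_def)
      then show "fact (N - 1) * f k \<in> \<int>" by simp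
    qed
    show ?thesis unfolding r_def right_diff_distrib using 1 2 by (rule Ints_diff)
  qed
  then obtain z :: int where "fact (N - 1) * r = of_int z" by (elim Ints_cases)
  moreover have "fact (N - 1) * r > 0" using rpos by simp
  ultimately show False using lt by simp
qed

section \<open>Choice of the parameters and proof of the theorem\<close>

theorem theorem2:
  fixes \<epsilon> :: real
  assumes "\<epsilon> > 0"
  shows "infinite {(m, n) :: nat \<times> nat | m n. m \<ge> 1 \<and> n \<ge> 1 \<and>
    \<bar>(\<Sum>l = n..m. 1 / real l) - 1\<bar>
      \<le> 1 / ((real n)\<^sup>2 * (ln (real n)) powr (5 / 4 - \<epsilon>))}"
    (is "infinite ?Z")
proof -
  \<comment> \<open>The cap at 1 keeps \<open>5 / 4 - e\<close> positive and \<open>e / 4\<close>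
    below \<open>1 / 2\<close>; as \<open>ln n \<ge> 1\<close>, a smaller \<open>e\<close> only
    strengthens the bound.\<close>
  define e where "e = min \<epsilon> 1"
  have e: "0 < e" "e \<le> 1" "e \<le> \<epsilon>" using assms by (auto simp: e_def)
  define c where "c = sinh (1::real) / 3"
  have c: "1 / 4 \<le> c" "c \<le> 1 / 2"
  proof -
    define u :: real where "u = exp 1"
    define v :: real where "v = exp (- 1)"
    have u: "2 \<le> u" "u \<le> 3" using exp_ge_add_one_self[of 1] exp_le by (simp_all add: u_def)
    have "v = 1 / u" by (simp add: u_def v_def exp_minus inverse_eq_divide)
    then have v: "0 \<le> v" "v \<le> 1 / 2" using u by simp_all
    have "c = (u - v) / 6" by (simp add: c_def sinh_1_eq u_def v_def)
    then show "1 / 4 \<le> c" "c \<le> 1 / 2" using u v by simp_all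
  qed
  have irr: "1 / c \<notin> \<rat>"
  proof
    assume "1 / c \<in> \<rat>"
    then have "3 * inverse (1 / c) \<in> \<rat>" by (intro Rats_mult Rats_inverse) auto
    then show False using sinh_1_irrational by (simp add: c_def)
  qed
  obtain C :: real and N :: nat where C: "C > 0" and CN:
    "\<And>k t n m. odd k \<Longrightarrow> N \<le> k \<Longrightarrow> 2 * n = t * pade_den k + 1 \<Longrightarrow> 2 * m + 1 = t * pade_num k \<Longrightarrow>
       (real t)\<^sup>2 * (real (pade_den k) * pade_err k) \<le> 1 \<Longrightarrow>
       \<bar>(\<Sum>l=n..m. 1 / real l) - 1\<bar> \<le>
         (\<bar>(real t)\<^sup>2 * (real (pade_den k) * pade_err k) - sinh 1 / 3\<bar> + C / real (pade_den k))
           / (real t * real (pade_den k))\<^sup>2"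
    by (rule harmonic_block_pade) (rule that)
  define B where "B = (\<lambda>x::real. 20 * x powr (- 1 / 2 + e / 4) / x\<^sup>2 + 16 * C / x ^ 4)"
  define L where "L = (\<lambda>x::real. ln x + 3 * x\<^sup>2 * ln (12 * x\<^sup>2 + 3))"
  \<comment> \<open>\<open>B\<close> will bound the numerator of the error and \<open>L\<close> the
    logarithm of \<open>n\<close>. Up to logarithms the product has exponent
    \<open>- 5 / 2 + e / 4 + 2 * (5 / 4 - e) = - 7 * e / 4\<close>.\<close>
  have "eventually (\<lambda>x. B x * L x powr (5 / 4 - e) \<le> 1) at_top"
    unfolding B_def L_def using e C by real_asymp
  then obtain T where T: "\<And>x. x \<ge> T \<Longrightarrow> B x * L x powr (5 / 4 - e) \<le> 1"
    by (auto simp: eventually_at_top_linorder)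
  have unbounded: "\<exists>m n. (m, n) \<in> ?Z \<and> n > M" for M
  proof -
    \<comment> \<open>The shift is chosen so that the quadratic expression equals
      \<open>(t\<^sup>2 / c - 3) / 4\<close> for \<open>t = 2 * s + 1\<close>. Closeness to an
      integer \<open>i\<close> then means that \<open>t\<^sup>2 / c\<close> is close to
      \<open>4 * i + 3\<close>, which is \<open>2 * k + 1\<close> for the odd index
      \<open>k = 2 * i + 1\<close>.\<close>
    obtain s :: nat where s: "s \<ge> M + N + 3 + nat \<lceil>T\<rceil>" "s > 0" and
      "nint_dist (1 / c * ((real s)\<^sup>2 + real s) + (1 / (4 * c) - 3 / 4)) \<le> real s powr (- 1 / 2 + e / 4)"
      (is "nint_dist ?y \<le> _")
      by (rule exists_quadratic_near_int[OF irr, of "e / 4"]) (use e in auto)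
    define y where "y = ?y"
    define i where "i = round y"
    define t where "t = 2 * s + 1"
    have t: "real t \<ge> 7" "real t \<ge> T" "t > M" "t \<ge> N" using s by (simp_all add: t_def) linarith
    have "4 * y = (real t)\<^sup>2 / c - 3"
      using c by (simp add: y_def t_def field_simps power2_eq_square)
    then have near: "\<bar>(real t)\<^sup>2 / c - (4 * of_int i + 3)\<bar> \<le> 4 * real s powr (- 1 / 2 + e / 4)"
      using \<open>nint_dist ?y \<le> _\<close> unfolding y_def[symmetric] nint_dist_def i_def[symmetric] by linarith
    have near1: "real s powr (- 1 / 2 + e / 4) \<le> 1"
      using s e powr_mono[of "- 1 / 2 + e / 4" 0 "real s"] by simp
    have tc: "2 * (real t)\<^sup>2 \<le> (real t)\<^sup>2 / c" "(real t)\<^sup>2 / c \<le> 4 * (real t)\<^sup>2"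
      using c mult_left_mono[of c "1 / 2" "2 * (real t)\<^sup>2"] mult_left_mono[of "1 / 4" c "4 * (real t)\<^sup>2"]
      by (simp_all add: field_simps)
    have t2: "(real t)\<^sup>2 \<ge> 7 * real t" using t mult_right_mono[of 7 "real t" "real t"] by (simp add: power2_eq_square)
    have i0: "i > 0"
    proof -
      have "real_of_int i > 0" using near near1 tc t2 t by linarith
      then show ?thesis by simp
    qed
    define k where "k = nat (2 * i + 1)"
    have k: "odd k" "2 * real k + 1 = 4 * of_int i + 3"
      using i0 by (auto simp: k_def even_nat_iff)
    have k_ge: "2 * real k + 1 \<ge> (real t)\<^sup>2" and k_le: "real k \<le> 3 * (real t)\<^sup>2"
      using near near1 tc t2 t unfolding k(2)[symmetric] by linarith+
    have k_ge': "real k \<ge> (real t)\<^sup>2 / 4" using k_ge t2 t by linarith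
    have "real k \<ge> real t" using k_ge' t2 t k_ge by linarith
    then have kN: "k \<ge> N" "k > 0" using t by linarith+
    define Q where "Q = real (pade_den k)"
    define A where "A = 1 / (Q * pade_err k)"
    have QA: "Q * pade_err k = 1 / A" by (simp add: A_def)
    have A: "2 * real k + 1 \<le> A" "A \<le> 2 * real k + 1 + 1 / real k"
      using pade_product_bounds[OF kN(2)] by (simp_all add: A_def Q_def)
    have A_ge: "A \<ge> (real t)\<^sup>2" "A > 0" using A k_ge by linarith+
    have "odd (t * pade_den k)" "odd (t * pade_num k)"
      using odd_pade_den odd_pade_num by (simp_all add: t_def)
    then obtain n' m where n': "t * pade_den k = 2 * n' + 1" and m: "2 * m + 1 = t * pade_num k"
      by (metis oddE)
    define n where "n = n' + 1"
    have n: "2 * n = t * pade_den k + 1" using n' by (simp add: n_def)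
    have Qk: "Q \<ge> (real k)\<^sup>2"
      using of_nat_mono[OF pade_den_ge_square[of k], where ?'a = real] by (simp add: Q_def)
    have Q1: "Q \<ge> 1" using pade_den_pos[of k] by (simp add: Q_def)
    have "t * 1 \<le> t * pade_den k" using pade_den_pos[of k] by (intro mult_le_mono2) simp
    then have n_ge: "n > s" "n \<ge> 4" using n s by (simp_all add: t_def)
    have "t * 1 \<le> t * pade_num k" using pade_num_pos[of k] by (intro mult_le_mono2) simp
    then have m1: "m \<ge> 1" using m t by linarith
    define q where "q = real t * Q"
    have nq: "2 * real n = q + 1" using arg_cong[OF n, of real] by (simp add: q_def Q_def)
    have n_le: "real n \<le> q" using nq n_ge by linarith

    have main: "\<bar>(\<Sum>l=n..m. 1 / real l) - 1\<bar> \<le> (\<bar>(real t)\<^sup>2 * (1 / A) - c\<bar> + C / Q) / q\<^sup>2"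
      using CN[OF k(1) kN(1) n m] A_ge unfolding Q_def[symmetric] QA q_def c_def by (simp add: field_simps)
    \<comment> \<open>Passing from \<open>s\<close> to \<open>t\<close> costs a factor 4, which
      makes 16 with the factor 4 in \<open>near\<close>; the gap \<open>1 / k\<close> between
      \<open>A\<close> and \<open>2 * k + 1\<close> adds the remaining 4.\<close>
    have "\<bar>(real t)\<^sup>2 / c - A\<bar> \<le> 20 * real t powr (- 1 / 2 + e / 4)"
    proof -
      have "real s powr (- 1 / 2 + e / 4) \<le> (real t / 4) powr (- 1 / 2 + e / 4)"
        using s e by (intro powr_mono2') (auto simp: t_def)
      also have "\<dots> = real t powr (- 1 / 2 + e / 4) * 4 powr (1 / 2 - e / 4)"
        using t powr_minus_divide[of 4 "1 / 2 - e / 4"] by (simp add: powr_divide)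
      also have "\<dots> \<le> real t powr (- 1 / 2 + e / 4) * 4 powr 1"
        using e by (intro mult_left_mono powr_mono) auto
      finally have 1: "4 * real s powr (- 1 / 2 + e / 4) \<le> 16 * real t powr (- 1 / 2 + e / 4)" by simp
      have "1 / real k \<le> 1 / ((real t)\<^sup>2 / 4)" using k_ge' t kN by (intro divide_left_mono) auto
      also have "\<dots> = 4 * real t powr (- 2)" using t by (simp add: powr_minus_divide)
      also have "\<dots> \<le> 4 * real t powr (- 1 / 2 + e / 4)" using e t by (intro mult_left_mono powr_mono) auto
      finally show ?thesis using near A 1 unfolding k(2)[symmetric] by linarith
    qed
    then have "\<bar>(real t)\<^sup>2 / c - A\<bar> * (c / A) \<le> 20 * real t powr (- 1 / 2 + e / 4) * (1 / (real t)\<^sup>2)"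
      using c A_ge t by (intro mult_mono frac_le) auto
    moreover have "\<bar>(real t)\<^sup>2 / c - A\<bar> * (c / A) = \<bar>(real t)\<^sup>2 * (1 / A) - c\<bar>"
    proof -
      have "((real t)\<^sup>2 / c - A) * (c / A) = (real t)\<^sup>2 * (1 / A) - c" using c A_ge(2) by (simp add: field_simps)
      moreover have "\<bar>c / A\<bar> = c / A" using c A_ge by simp
      ultimately show ?thesis by (metis abs_mult)
    qed
    moreover have "C / Q \<le> 16 * C / real t ^ 4"
    proof -
      have "((real t)\<^sup>2 / 4)\<^sup>2 \<le> (real k)\<^sup>2" using k_ge' by (intro power_mono) auto
      then have "real t ^ 4 / 16 \<le> Q" using Qk by (simp add: power_divide)
      then have "C / Q \<le> C / (real t ^ 4 / 16)" using C t Q1 by (intro divide_left_mono) auto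
      then show ?thesis by (simp add: mult.commute)
    qed
    ultimately have "\<bar>(real t)\<^sup>2 * (1 / A) - c\<bar> + C / Q \<le> B (real t)"
      by (simp add: B_def)
    then have "(\<bar>(real t)\<^sup>2 * (1 / A) - c\<bar> + C / Q) / q\<^sup>2 \<le> B (real t) / q\<^sup>2"
      by (intro divide_right_mono) auto
    also have "\<dots> \<le> B (real t) / (real n)\<^sup>2"
      using n_le n_ge C by (intro divide_left_mono power_mono) (auto simp: B_def)
    finally have bound: "\<bar>(\<Sum>l=n..m. 1 / real l) - 1\<bar> \<le> B (real t) / (real n)\<^sup>2"
      using main by linarith

    have ln1: "ln (real n) \<ge> 1"
    proof -
      have "exp 1 \<le> real n" using exp_le n_ge by linarith
      then show ?thesis using n_ge by (simp add: ln_ge_iff)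
    qed
    have "ln (real n) \<le> ln q" using n_le n_ge by simp
    also have "\<dots> = ln (real t) + ln Q" using t Q1 by (simp add: q_def ln_mult)
    also have "\<dots> \<le> ln (real t) + real k * ln (4 * real k + 3)"
      using ln_pade_den_le[of k] by (simp add: Q_def)
    also have "\<dots> \<le> L (real t)"
      unfolding L_def using k_le by (intro add_left_mono mult_mono) auto
    finally have lnL: "ln (real n) \<le> L (real t)" .
    have "ln (real n) powr (5 / 4 - \<epsilon>) \<le> ln (real n) powr (5 / 4 - e)"
      using ln1 e by (intro powr_mono) auto
    also have "\<dots> \<le> L (real t) powr (5 / 4 - e)"
      using lnL ln1 e by (intro powr_mono2) auto
    finally have "B (real t) * ln (real n) powr (5 / 4 - \<epsilon>) \<le> B (real t) * L (real t) powr (5 / 4 - e)"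
      using C by (intro mult_left_mono) (auto simp: B_def)
    also have "\<dots> \<le> 1" by (rule T[OF t(2)])
    finally have "B (real t) \<le> 1 / ln (real n) powr (5 / 4 - \<epsilon>)"
      using ln1 by (simp add: field_simps)
    then have "B (real t) / (real n)\<^sup>2 \<le> 1 / ln (real n) powr (5 / 4 - \<epsilon>) / (real n)\<^sup>2"
      by (intro divide_right_mono) auto
    then have "\<bar>(\<Sum>l=n..m. 1 / real l) - 1\<bar> \<le> 1 / ((real n)\<^sup>2 * ln (real n) powr (5 / 4 - \<epsilon>))"
      using bound by (simp add: mult.commute)
    then have "(m, n) \<in> ?Z" using m1 n_ge by auto
    moreover have "n > M" using n_ge s by linarith
    ultimately show ?thesis by blast
  qed
  \<comment> \<open>Unboundedness of the second coordinate already excludes finiteness.\<close>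
  show ?thesis
  proof
    assume "finite ?Z"
    then have fin: "finite (snd ` ?Z)" by (rule finite_imageI)
    obtain m n where mn: "(m, n) \<in> ?Z" "n > Max (snd ` ?Z)" using unbounded by blast
    from mn(1) have "n \<in> snd ` ?Z" by (rule rev_image_eqI) simp
    then have "n \<le> Max (snd ` ?Z)" by (rule Max_ge[OF fin])
    then show False using mn(2) by simp
  qed
qed

end
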